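(* Let $(A;\{E_i\}_{i=0}^d;A^*;\{E^*_i\}_{i=0}^d)$ be a Leonard system in $\mathcal{A}$ and let $S$ denote the corresponding switching element. Then for all nonzero $X\in\mathcal{A}$ the following (i), (ii) are equivalent. (i) $X$ is a scalar multiple of $S$. (ii) $X[0]\subseteq[0]$, $X[D]\subseteq[D]$, and $X[0^*]\subseteq[D^*]$. Suppose (i), (ii) hold. Then equality is attained everywhere in (ii).
   Context: $\mathbb{K}$ is a field, $d\ge 0$ an integer, $\mathcal{A}$ a $\mathbb{K}$-algebra isomorphic to $\mathrm{Mat}_{d+1}(\mathbb{K})$, $I$ its identity, and $V$ a simple left $\mathcal{A}$-module (so $\dim V=d+1$). The symbol $A^*$ is just a name for a second element (not a conjugate transpose). An element $A\in\mathcal{A}$ is multiplicity-free if it has $d+1$ mutually distinct eigenvalues in $\mathbb{K}$. For an ordering $\{\theta_i\}_{i=0}^d$ of these eigenvalues, the primitive idempotent of $A$ associated with $\theta_i$ is $E_i=\prod_{0\le j\le d,\,j\ne i}\frac{A-\theta_jI}{\theta_i-\theta_j}$. A Leonard system in $\mathcal{A}$ is a sequence $\Phi=(A;\{E_i\}_{i=0}^d;A^*;\{E^*_i\}_{i=0}^d)$ such that $A,A^*\in\mathcal{A}$ are multiplicity-free; $\{E_i\}_{i=0}^d$ (resp. $\{E^*_i\}_{i=0}^d$) is an ordering of the primitive idempotents of $A$ (resp. $A^*$); and for $0\le i,j\le d$ both $E_iA^*E_j$ and $E^*_iAE^*_j$ are zero if $|i-j|>1$ and nonzero if $|i-j|=1$.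 Let $\theta_i$ (resp. $\theta^*_i$) be the eigenvalue of $A$ (resp. $A^*$) associated with $E_i$ (resp. $E^*_i$). Put $\tau_i=(\lambda-\theta_0)(\lambda-\theta_1)\cdots(\lambda-\theta_{i-1})$ and $\eta_i=(\lambda-\theta_d)(\lambda-\theta_{d-1})\cdots(\lambda-\theta_{d-i+1})$ for $0\le i\le d$. The first and second split sequences of $\Phi$ are, for $1\le i\le d$, $\varphi_i=(\theta^*_0-\theta^*_i)\frac{\mathrm{tr}(\tau_i(A)E^*_0)}{\mathrm{tr}(\tau_{i-1}(A)E^*_0)}$ and $\phi_i=(\theta^*_0-\theta^*_i)\frac{\mathrm{tr}(\eta_i(A)E^*_0)}{\mathrm{tr}(\eta_{i-1}(A)E^*_0)}$ (the denominators are known to be nonzero, and all $\varphi_i,\phi_i$ are known to be nonzero). The switching element for $\Phi$ is $S=\sum_{r=0}^d\frac{\phi_d\phi_{d-1}\cdots\phi_{d-r+1}}{\varphi_1\varphi_2\cdots\varphi_r}E_r$. Flags: $[0],[D],[0^*],[D^*]$ are the sequences of subspaces of $V$, indexed by $0\le i\le d$, whose $i$th components are respectively $E_0V+\cdots+E_iV$; $E_dV+E_{d-1}V+\cdots+E_{d-i}V$; $E^*_0V+\cdots+E^*_iV$; $E^*_dV+E^*_{d-1}V+\cdots+E^*_{d-i}V$. For a sequence $F=\{F_i\}_{i=0}^d$ of subspaces of $V$ and $X\in\mathcal{A}$, $XF$ denotes $\{XF_i\}_{i=0}^d$; for two such sequences, $F\subseteq F'$ means $F_i\subseteq F'_i$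 for $0\le i\le d$. *)

theory Defs
  imports "Jordan_Normal_Form.Char_Poly" "HOL-Library.Set_Algebras"
begin

text \<open>
  A matrix algebra is a type \<open>'a\<close> carrying a \<open>'k\<close>-algebra structure with scalar
  multiplication \<open>scale\<close>, together with an isomorphism \<open>\<rho>\<close> onto the square
  matrices of size \<open>d + 1\<close>. Eigenvalues and traces of an element \<open>X\<close> are those of the
  matrix \<open>\<rho> X\<close>; they do not depend on which isomorphism is used, because any two
  differ by a conjugation.
\<close>

locale matrix_algebra = vector_space scale
  for scale :: "'k::field \<Rightarrow> 'a::ring_1 \<Rightarrow> 'a" +
  fixes d :: nat and \<rho> :: "'a \<Rightarrow> 'k mat"
  assumes scale_mult_left: "scale c x * y = scale c (x * y)"
    and scale_mult_right: "x * scale c y = scale c (x * y)"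
    and iso_bij: "bij_betw \<rho> UNIV (carrier_mat (d + 1) (d + 1))"
    and iso_add: "\<rho> (x + y) = \<rho> x + \<rho> y"
    and iso_scale: "\<rho> (scale c x) = c \<cdot>\<^sub>m \<rho> x"
    and iso_mult: "\<rho> (x * y) = \<rho> x * \<rho> y"
    and iso_one: "\<rho> 1 = 1\<^sub>m (d + 1)"

text \<open>
  The vector space structure of a module \<open>'v\<close> over such an algebra is the induced one:
  \<open>c\<close> acts as \<open>scale c 1\<close>. In particular submodules are automatically subspaces.
\<close>

locale left_module =
  fixes act :: "'a::ring_1 \<Rightarrow> 'v::ab_group_add \<Rightarrow> 'v"
  assumes act_add_right: "act x (v + w) = act x v + act x w"
    and act_add_left: "act (x + y) v = act x v + act y v"
    and act_mult: "act (x * y) v = act x (act y v)"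
    and act_one: "act 1 v = v"

definition submodule :: "('a::ring_1 \<Rightarrow> 'v::ab_group_add \<Rightarrow> 'v) \<Rightarrow> 'v set \<Rightarrow> bool" where
  "submodule act W \<longleftrightarrow>
     0 \<in> W \<and> (\<forall>v\<in>W. \<forall>w\<in>W. v + w \<in> W) \<and> (\<forall>x. \<forall>v\<in>W. act x v \<in> W)"

locale simple_left_module = left_module act
  for act :: "'a::ring_1 \<Rightarrow> 'v::ab_group_add \<Rightarrow> 'v" +
  assumes nonzero: "\<exists>v::'v. v \<noteq> 0"
    and simple: "submodule act W \<Longrightarrow> W = {0} \<or> W = UNIV"

definition alg_trace :: "nat \<Rightarrow> ('a \<Rightarrow> 'k::field mat) \<Rightarrow> 'a \<Rightarrow> 'k" where
  "alg_trace d \<rho> X = (\<Sum>i\<le>d. \<rho> X $$ (i, i))"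

definition multiplicity_free :: "nat \<Rightarrow> ('a \<Rightarrow> 'k::field mat) \<Rightarrow> 'a \<Rightarrow> bool" where
  "multiplicity_free d \<rho> X \<longleftrightarrow> card {t. eigenvalue (\<rho> X) t} = d + 1"

text \<open>
  The algebra is noncommutative, so the product is taken over a list; its factors commute
  with one another, being polynomials in \<open>X\<close>.
\<close>

definition primitive_idempotent ::
  "('k::field \<Rightarrow> 'a::ring_1 \<Rightarrow> 'a) \<Rightarrow> nat \<Rightarrow> 'a \<Rightarrow> (nat \<Rightarrow> 'k) \<Rightarrow> nat \<Rightarrow> 'a" where
  "primitive_idempotent scale d X \<theta> i =
     prod_list (map (\<lambda>j. scale (1 / (\<theta> i - \<theta> j)) (X - scale (\<theta> j) 1))
                    (filter (\<lambda>j. j \<noteq> i) [0..<d + 1]))"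

text \<open>
  \<open>\<theta>\<close> is an ordering of the eigenvalues of \<open>X\<close>, and \<open>E i\<close> is the primitive
  idempotent of \<open>X\<close> associated with \<open>\<theta> i\<close>. All sequences are indexed by
  \<open>0, \<dots>, d\<close>; values at larger indices are irrelevant.
\<close>

definition associated_eigenvalues ::
  "('k::field \<Rightarrow> 'a::ring_1 \<Rightarrow> 'a) \<Rightarrow> nat \<Rightarrow> ('a \<Rightarrow> 'k mat) \<Rightarrow> 'a \<Rightarrow> (nat \<Rightarrow> 'a)
    \<Rightarrow> (nat \<Rightarrow> 'k) \<Rightarrow> bool" where
  "associated_eigenvalues scale d \<rho> X E \<theta> \<longleftrightarrow>
     bij_betw \<theta> {..d} {t. eigenvalue (\<rho> X) t} \<and>
     (\<forall>i\<le>d. E i = primitive_idempotent scale d X \<theta> i)"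

definition leonard_system ::
  "('k::field \<Rightarrow> 'a::ring_1 \<Rightarrow> 'a) \<Rightarrow> nat \<Rightarrow> ('a \<Rightarrow> 'k mat) \<Rightarrow>
   'a \<Rightarrow> (nat \<Rightarrow> 'a) \<Rightarrow> 'a \<Rightarrow> (nat \<Rightarrow> 'a) \<Rightarrow> bool" where
  "leonard_system scale d \<rho> A E As Es \<longleftrightarrow>
     multiplicity_free d \<rho> A \<and> multiplicity_free d \<rho> As \<and>
     (\<exists>\<theta>. associated_eigenvalues scale d \<rho> A E \<theta>) \<and>
     (\<exists>\<theta>s. associated_eigenvalues scale d \<rho> As Es \<theta>s) \<and>
     (\<forall>i\<le>d. \<forall>j\<le>d.
        (\<bar>int i - int j\<bar> > 1 \<longrightarrow> E i * As * E j = 0 \<and> Es i * A * Es j = 0) \<and>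
        (\<bar>int i - int j\<bar> = 1 \<longrightarrow> E i * As * E j \<noteq> 0 \<and> Es i * A * Es j \<noteq> 0))"

definition poly_eval :: "('k::field \<Rightarrow> 'a::ring_1 \<Rightarrow> 'a) \<Rightarrow> 'k poly \<Rightarrow> 'a \<Rightarrow> 'a" where
  "poly_eval scale p X = (\<Sum>n\<le>degree p. scale (coeff p n) (X ^ n))"

definition tau_poly :: "(nat \<Rightarrow> 'k::field) \<Rightarrow> nat \<Rightarrow> 'k poly" where
  "tau_poly \<theta> i = (\<Prod>h<i. [:- \<theta> h, 1:])"

definition eta_poly :: "nat \<Rightarrow> (nat \<Rightarrow> 'k::field) \<Rightarrow> nat \<Rightarrow> 'k poly" where
  "eta_poly d \<theta> i = (\<Prod>h<i. [:- \<theta> (d - h), 1:])"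

definition first_split ::
  "('k::field \<Rightarrow> 'a::ring_1 \<Rightarrow> 'a) \<Rightarrow> nat \<Rightarrow> ('a \<Rightarrow> 'k mat) \<Rightarrow>
   'a \<Rightarrow> (nat \<Rightarrow> 'k) \<Rightarrow> (nat \<Rightarrow> 'a) \<Rightarrow> (nat \<Rightarrow> 'k) \<Rightarrow> nat \<Rightarrow> 'k" where
  "first_split scale d \<rho> A \<theta> Es \<theta>s i =
     (\<theta>s 0 - \<theta>s i) *
     (alg_trace d \<rho> (poly_eval scale (tau_poly \<theta> i) A * Es 0) /
      alg_trace d \<rho> (poly_eval scale (tau_poly \<theta> (i - 1)) A * Es 0))"

definition second_split ::
  "('k::field \<Rightarrow> 'a::ring_1 \<Rightarrow> 'a) \<Rightarrow> nat \<Rightarrow> ('a \<Rightarrow> 'k mat) \<Rightarrow>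
   'a \<Rightarrow> (nat \<Rightarrow> 'k) \<Rightarrow> (nat \<Rightarrow> 'a) \<Rightarrow> (nat \<Rightarrow> 'k) \<Rightarrow> nat \<Rightarrow> 'k" where
  "second_split scale d \<rho> A \<theta> Es \<theta>s i =
     (\<theta>s 0 - \<theta>s i) *
     (alg_trace d \<rho> (poly_eval scale (eta_poly d \<theta> i) A * Es 0) /
      alg_trace d \<rho> (poly_eval scale (eta_poly d \<theta> (i - 1)) A * Es 0))"

definition switching_element ::
  "('k::field \<Rightarrow> 'a::ring_1 \<Rightarrow> 'a) \<Rightarrow> nat \<Rightarrow> ('a \<Rightarrow> 'k mat) \<Rightarrow>
   'a \<Rightarrow> (nat \<Rightarrow> 'a) \<Rightarrow> (nat \<Rightarrow> 'k) \<Rightarrow> (nat \<Rightarrow> 'a) \<Rightarrow> (nat \<Rightarrow> 'k) \<Rightarrow> 'a" where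
  "switching_element scale d \<rho> A E \<theta> Es \<theta>s =
     (\<Sum>r\<le>d. scale
        ((\<Prod>h<r. second_split scale d \<rho> A \<theta> Es \<theta>s (d - h)) /
         (\<Prod>h=1..r. first_split scale d \<rho> A \<theta> Es \<theta>s h))
        (E r))"

text \<open>
  The sums below are sums of sets of vectors (from \<open>Set_Algebras\<close>): the \<open>i\<close>-th component
  of \<open>flag_up act E\<close> is \<open>E 0 V + \<dots> + E i V\<close>, and that of \<open>flag_down act d E\<close> is
  \<open>E d V + \<dots> + E (d - i) V\<close>.
\<close>

definition flag_up ::
  "('a \<Rightarrow> 'v::ab_group_add \<Rightarrow> 'v) \<Rightarrow> (nat \<Rightarrow> 'a) \<Rightarrow> nat \<Rightarrow> 'v set" where
  "flag_up act E i = (\<Sum>j\<le>i. range (act (E j)))"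

definition flag_down ::
  "('a \<Rightarrow> 'v::ab_group_add \<Rightarrow> 'v) \<Rightarrow> nat \<Rightarrow> (nat \<Rightarrow> 'a) \<Rightarrow> nat \<Rightarrow> 'v set" where
  "flag_down act d E i = (\<Sum>j\<le>i. range (act (E (d - j))))"

definition flag_image :: "('a \<Rightarrow> 'v \<Rightarrow> 'v) \<Rightarrow> 'a \<Rightarrow> (nat \<Rightarrow> 'v set) \<Rightarrow> nat \<Rightarrow> 'v set" where
  "flag_image act X F i = act X ` F i"

definition flag_subset :: "nat \<Rightarrow> (nat \<Rightarrow> 'v set) \<Rightarrow> (nat \<Rightarrow> 'v set) \<Rightarrow> bool" where
  "flag_subset d F G \<longleftrightarrow> (\<forall>i\<le>d. F i \<subseteq> G i)"

definition flag_eq :: "nat \<Rightarrow> (nat \<Rightarrow> 'v set) \<Rightarrow> (nat \<Rightarrow> 'v set) \<Rightarrow> bool" where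
  "flag_eq d F G \<longleftrightarrow> (\<forall>i\<le>d. F i = G i)"

end

theory Submission
  imports Defs
begin

text \<open>
  An element that stabilises both the up flag and the down flag of the \<open>E\<^sub>i\<close> stabilises each line
  \<open>E\<^sub>i V\<close>. Let \<open>x\<close> generate \<open>E\<^sup>*\<^sub>0 V\<close> and \<open>y\<close> generate \<open>E\<^sup>*\<^sub>d V\<close>. Since \<open>x\<close> has a component in every
  \<open>E\<^sub>i V\<close>, such an element is determined by its value at \<open>x\<close>, and the condition on the third flag puts
  this value on the line of \<open>y\<close>. So the elements in question form a space of dimension at most one, and
  all comes down to showing that \<open>S x\<close> is a nonzero multiple of \<open>y\<close> (lemma \<open>E_y\<close>). Everything else
  follows from this: \<open>S\<close> commutes with \<open>A\<close>, the vectors \<open>\<tau>\<^sub>j(A) x\<close> with \<open>j \<le> i\<close> span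
  \<open>E\<^sup>*\<^sub>0 V + \<dots> + E\<^sup>*\<^sub>i V\<close>, and the \<open>\<tau>\<^sub>j(A) y\<close> span \<open>E\<^sup>*\<^sub>d V + \<dots> + E\<^sup>*\<^sub>d\<^sub>-\<^sub>i V\<close>.

  To compare \<open>x\<close> and \<open>y\<close>, consider the split basis \<open>u\<^sub>i = \<tau>\<^sub>i(A) x\<close>. It satisfies
  \<open>A\<^sup>* u\<^sub>i = \<theta>\<^sup>*\<^sub>i u\<^sub>i + p\<^sub>i u\<^sub>i\<^sub>-\<^sub>1\<close>, where \<open>p\<close> is the first split sequence
  (lemma \<open>B_u_split\<close>). Two components of this recurrence matter. The one in \<open>E\<^sub>i\<^sub>-\<^sub>1 V\<close> expresses the
  entry of \<open>A\<^sup>*\<close> from \<open>E\<^sub>i V\<close> to \<open>E\<^sub>i\<^sub>-\<^sub>1 V\<close> by \<open>p\<^sub>i\<close>. With the order of the \<open>E\<^sup>*\<^sub>i\<close> reversed the same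
  holds for \<open>y\<close> and another split sequence \<open>p'\<close>, so that the ratios \<open>k\<^sub>i\<close> of the components of \<open>y\<close> and
  \<open>x\<close> in \<open>E\<^sub>i V\<close> satisfy \<open>k\<^sub>i / k\<^sub>i\<^sub>-\<^sub>1 = p'\<^sub>i / p\<^sub>i\<close>. The component in \<open>E\<^sub>i V\<close> gives the diagonal
  entries of \<open>A\<^sup>*\<close> (lemma \<open>diagonal_entry\<close>); comparing the formulas for different orderings
  identifies \<open>p'\<^sub>i\<close> with the term of index \<open>d - i + 1\<close> of the second split sequence (lemma
  \<open>opp_split_param\<close>). The resulting product of ratios is the coefficient of \<open>E\<^sub>i\<close> in \<open>S\<close>.

  This argument concerns two operators on a vector space. It applies to \<open>V\<close> because the matrix
  units of the algebra give \<open>V\<close> coordinates in which every element acts by its matrix; in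
  particular \<open>V\<close> is faithful of dimension \<open>d + 1\<close>, and the traces in the split sequences are
  coordinates along \<open>x\<close>.
\<close>

section \<open>Multiplicity-free operators\<close>

lemma sum_single:
  assumes "k \<le> (n::nat)" "\<And>j. j \<le> n \<Longrightarrow> j \<noteq> k \<Longrightarrow> f j = 0"
  shows "(\<Sum>j\<le>n. f j) = f k"
proof -
  have "(\<Sum>j\<le>n. f j) = (\<Sum>j\<le>n. if j = k then f j else 0)"
    using assms(2) by (intro sum.cong) auto
  then show ?thesis using assms(1) by simp
qed

text \<open>
  A diagonalisable operator with simple spectrum, given by its eigenvalues and the projections
  onto its eigenlines. The eigenlines have no preferred generators, so no eigenbasis is
  fixed: one-dimensionality is the statement that any two values of \<open>E i\<close> are proportional.
\<close>

locale eigen_decomposition = vector_space smul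
  for smul :: "'k::field \<Rightarrow> 'v::ab_group_add \<Rightarrow> 'v" (infixr "*s" 75) +
  fixes d :: nat and T :: "'v \<Rightarrow> 'v" and E :: "nat \<Rightarrow> 'v \<Rightarrow> 'v" and \<theta> :: "nat \<Rightarrow> 'k"
  assumes hom_T: "module_hom smul smul T"
    and hom_E: "i \<le> d \<Longrightarrow> module_hom smul smul (E i)"
    and E_E: "i \<le> d \<Longrightarrow> j \<le> d \<Longrightarrow> E i (E j v) = (if i = j then E j v else 0)"
    and sum_E: "(\<Sum>i\<le>d. E i v) = v"
    and T_E: "i \<le> d \<Longrightarrow> T (E i v) = \<theta> i *s E i v"
    and E_nonzero: "i \<le> d \<Longrightarrow> \<exists>v. E i v \<noteq> 0"
    and E_rank1: "i \<le> d \<Longrightarrow> E i v \<noteq> 0 \<Longrightarrow> \<exists>c. E i y = c *s E i v"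
    and \<theta>_inj: "inj_on \<theta> {..d}"
begin

lemmas T_simps = module_hom.zero[OF hom_T] module_hom.scale[OF hom_T] module_hom.add[OF hom_T]
  module_hom.diff[OF hom_T] module_hom.sum[OF hom_T]

lemmas E_simps = module_hom.zero[OF hom_E] module_hom.scale[OF hom_E] module_hom.add[OF hom_E]
  module_hom.diff[OF hom_E] module_hom.sum[OF hom_E]

lemma E_eqI:
  assumes "\<And>i. i \<le> d \<Longrightarrow> E i v = E i w"
  shows "v = w"
  using sum_E[of v] sum_E[of w] assms by (metis (no_types, lifting) atMost_iff sum.cong)

lemma E_sum:
  assumes "i \<le> d"
  shows "E i (\<Sum>j\<le>d. c j *s E j v) = c i *s E i v"
proof -
  have "E i (\<Sum>j\<le>d. c j *s E j v) = (\<Sum>j\<le>d. c j *s E i (E j v))"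
    using assms by (simp add: E_simps)
  also have "\<dots> = (\<Sum>j\<le>d. if i = j then c j *s E j v else 0)"
    using assms by (intro sum.cong) (auto simp: E_E)
  finally have "E i (\<Sum>j\<le>d. c j *s E j v) = (\<Sum>j\<le>d. if i = j then c j *s E j v else 0)" .
  then show ?thesis using assms by simp
qed

lemma E_T:
  assumes "i \<le> d"
  shows "E i (T v) = \<theta> i *s E i v"
proof -
  have "T v = T (\<Sum>j\<le>d. E j v)" by (simp only: sum_E)
  also have "\<dots> = (\<Sum>j\<le>d. \<theta> j *s E j v)" by (simp add: T_simps T_E)
  finally show ?thesis using assms by (simp add: E_sum)
qed

text \<open>
  Reversing the ordering of the eigenvalues gives the down flags from the up flags and the
  second split sequence from the first, so that each argument is needed for one ordering only.
\<close>

lemma reverse: "eigen_decomposition smul d T (\<lambda>i. E (d - i)) (\<lambda>i. \<theta> (d - i))"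
proof (intro eigen_decomposition.intro eigen_decomposition_axioms.intro)
  show "vector_space (*s)" by (rule vector_space_axioms)
  show "(\<Sum>i\<le>d. E (d - i) v) = v" for v
    using sum.nat_diff_reindex[of "\<lambda>i. E i v" "Suc d"] sum_E[of v]
    by (simp add: lessThan_Suc_atMost)
  show "inj_on (\<lambda>i. \<theta> (d - i)) {..d}"
  proof (rule inj_onI)
    fix i j assume "i \<in> {..d}" "j \<in> {..d}" "\<theta> (d - i) = \<theta> (d - j)"
    then show "i = j" using inj_onD[OF \<theta>_inj, of "d - i" "d - j"] by auto
  qed
  show "E (d - i) (E (d - j) v) = (if i = j then E (d - j) v else 0)" if "i \<le> d" "j \<le> d" for i j v
    using that by (auto simp: E_E)
  show "module_hom (*s) (*s) T" by (rule hom_T)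
  show "module_hom (*s) (*s) (E (d - i))" if "i \<le> d" for i by (simp add: hom_E)
  show "T (E (d - i) v) = \<theta> (d - i) *s E (d - i) v" if "i \<le> d" for i v by (simp add: T_E)
  show "\<exists>v. E (d - i) v \<noteq> 0" if "i \<le> d" for i by (simp add: E_nonzero)
  show "\<exists>c. E (d - i) y = c *s E (d - i) v" if "i \<le> d" "E (d - i) v \<noteq> 0" for i v y
    using that by (simp add: E_rank1)
qed

text \<open>
  The Newton basis of the polynomials of degree at most \<open>d\<close> with nodes \<open>\<theta>\<close>:
  \<open>newton i r\<close> is \<open>\<tau>\<^sub>i(\<theta>\<^sub>r)\<close>, and \<open>newton_vec v i\<close> is \<open>\<tau>\<^sub>i(T) v\<close> written
  in the eigenspaces of \<open>T\<close>.
\<close>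

definition newton :: "nat \<Rightarrow> nat \<Rightarrow> 'k" where
  "newton i r = (\<Prod>h<i. \<theta> r - \<theta> h)"

definition newton_vec :: "'v \<Rightarrow> nat \<Rightarrow> 'v" where
  "newton_vec v i = (\<Sum>r\<le>d. newton i r *s E r v)"

lemma newton_Suc: "newton (Suc i) r = newton i r * (\<theta> r - \<theta> i)"
  by (simp add: newton_def)

lemma newton_eq_0: "r < i \<Longrightarrow> newton i r = 0"
  by (auto simp: newton_def)

lemma \<theta>_neq: "i \<le> d \<Longrightarrow> j \<le> d \<Longrightarrow> i \<noteq> j \<Longrightarrow> \<theta> i - \<theta> j \<noteq> 0"
  using \<theta>_inj by (auto simp: inj_on_def)

lemma newton_nonzero: "i \<le> r \<Longrightarrow> r \<le> d \<Longrightarrow> newton i r \<noteq> 0"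
  using \<theta>_neq by (auto simp: newton_def)

lemma E_newton_vec: "r \<le> d \<Longrightarrow> E r (newton_vec v i) = newton i r *s E r v"
  by (simp add: newton_vec_def E_sum)

lemma newton_vec_0: "newton_vec v 0 = v"
  by (simp add: newton_vec_def newton_def sum_E)

lemma newton_vec_Suc: "newton_vec v (Suc i) = T (newton_vec v i) - \<theta> i *s newton_vec v i"
  by (rule E_eqI)
    (simp add: E_newton_vec E_T E_simps newton_Suc algebra_simps)

lemma newton_vec_above: "newton_vec v (Suc d) = 0"
  by (rule E_eqI) (simp add: E_newton_vec E_simps newton_eq_0)

end

section \<open>Leonard systems of operators\<close>

text \<open>
  The Leonard conditions for two operators on a vector space. They only see the
  distance of indices, so either ordering of eigenspaces may be reversed.
\<close>

locale leonard_action =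
  A: eigen_decomposition smul d A E \<theta> + B: eigen_decomposition smul d B Es \<theta>s
  for smul :: "'k::field \<Rightarrow> 'v::ab_group_add \<Rightarrow> 'v" (infixr "*s" 75)
    and d A E \<theta> B Es \<theta>s +
  assumes E_B_E_eq_0: "i \<le> d \<Longrightarrow> j \<le> d \<Longrightarrow> 1 < \<bar>int i - int j\<bar> \<Longrightarrow> E i (B (E j v)) = 0"
    and E_B_E_nonzero: "i \<le> d \<Longrightarrow> j \<le> d \<Longrightarrow> \<bar>int i - int j\<bar> = 1 \<Longrightarrow> \<exists>v. E i (B (E j v)) \<noteq> 0"
    and Es_A_Es_eq_0: "i \<le> d \<Longrightarrow> j \<le> d \<Longrightarrow> 1 < \<bar>int i - int j\<bar> \<Longrightarrow> Es i (A (Es j v)) = 0"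
    and Es_A_Es_nonzero: "i \<le> d \<Longrightarrow> j \<le> d \<Longrightarrow> \<bar>int i - int j\<bar> = 1 \<Longrightarrow> \<exists>v. Es i (A (Es j v)) \<noteq> 0"
begin

lemma reverse_E: "leonard_action smul d A (\<lambda>i. E (d - i)) (\<lambda>i. \<theta> (d - i)) B Es \<theta>s"
proof -
  interpret R: eigen_decomposition smul d A "\<lambda>i. E (d - i)" "\<lambda>i. \<theta> (d - i)"
    by (rule A.reverse)
  have *: "\<bar>int (d - i) - int (d - j)\<bar> = \<bar>int i - int j\<bar>" if "i \<le> d" "j \<le> d" for i j
    using that by linarith
  show ?thesis
  proof
    fix i j v assume ij: "i \<le> d" "j \<le> d" "1 < \<bar>int i - int j\<bar>"
    show "E (d - i) (B (E (d - j) v)) = 0"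
      by (rule E_B_E_eq_0) (use ij * in simp_all)
    show "Es i (A (Es j v)) = 0"
      by (rule Es_A_Es_eq_0) (use ij * in simp_all)
  next
    fix i j assume ij: "i \<le> d" "j \<le> d" "\<bar>int i - int j\<bar> = 1"
    show "\<exists>v. E (d - i) (B (E (d - j) v)) \<noteq> 0"
      by (rule E_B_E_nonzero) (use ij * in simp_all)
    show "\<exists>v. Es i (A (Es j v)) \<noteq> 0"
      by (rule Es_A_Es_nonzero) (use ij * in simp_all)
  qed
qed

lemma reverse_Es: "leonard_action smul d A E \<theta> B (\<lambda>i. Es (d - i)) (\<lambda>i. \<theta>s (d - i))"
proof -
  interpret R: eigen_decomposition smul d B "\<lambda>i. Es (d - i)" "\<lambda>i. \<theta>s (d - i)"
    by (rule B.reverse)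
  have *: "\<bar>int (d - i) - int (d - j)\<bar> = \<bar>int i - int j\<bar>" if "i \<le> d" "j \<le> d" for i j
    using that by linarith
  show ?thesis
  proof
    fix i j v assume ij: "i \<le> d" "j \<le> d" "1 < \<bar>int i - int j\<bar>"
    show "E i (B (E j v)) = 0"
      by (rule E_B_E_eq_0) (use ij * in simp_all)
    show "Es (d - i) (A (Es (d - j) v)) = 0"
      by (rule Es_A_Es_eq_0) (use ij * in simp_all)
  next
    fix i j assume ij: "i \<le> d" "j \<le> d" "\<bar>int i - int j\<bar> = 1"
    show "\<exists>v. E i (B (E j v)) \<noteq> 0"
      by (rule E_B_E_nonzero) (use ij * in simp_all)
    show "\<exists>v. Es (d - i) (A (Es (d - j) v)) \<noteq> 0"
      by (rule Es_A_Es_nonzero) (use ij * in simp_all)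
  qed
qed

lemma Es_A_expand:
  assumes "r \<le> d"
  shows "Es r (A v) = (\<Sum>j\<le>d. Es r (A (Es j v)))"
proof -
  have "Es r (A v) = Es r (A (\<Sum>j\<le>d. Es j v))" by (simp only: B.sum_E)
  also have "\<dots> = (\<Sum>j\<le>d. Es r (A (Es j v)))"
    by (simp only: A.T_simps B.E_simps[OF assms])
  finally show ?thesis .
qed

lemma E_B_expand:
  assumes "r \<le> d"
  shows "E r (B v) = (\<Sum>j\<le>d. E r (B (E j v)))"
proof -
  have "E r (B v) = E r (B (\<Sum>j\<le>d. E j v))" by (simp only: A.sum_E)
  also have "\<dots> = (\<Sum>j\<le>d. E r (B (E j v)))"
    by (simp only: B.T_simps A.E_simps[OF assms])
  finally show ?thesis .
qed

lemma E_Es_expand: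
  assumes "r \<le> d"
  shows "E r v = (\<Sum>j\<le>d. E r (Es j v))"
proof -
  have "E r v = E r (\<Sum>j\<le>d. Es j v)" by (simp only: B.sum_E)
  also have "\<dots> = (\<Sum>j\<le>d. E r (Es j v))"
    by (simp only: A.E_simps[OF assms])
  finally show ?thesis .
qed

end

text \<open>
  A Leonard system together with a generator \<open>x\<close> of the line \<open>Es 0\<close>. The vectors
  \<open>u i\<close> are \<open>\<tau>\<^sub>i(A) x\<close>; they form the split basis, on which \<open>A\<close> is lower and \<open>B\<close> is
  upper bidiagonal.
\<close>

locale leonard_vector = leonard_action +
  fixes x
  assumes Es_0_x: "Es 0 x = x" and x_nonzero: "x \<noteq> 0"
begin

abbreviation u :: "nat \<Rightarrow> 'b" where "u \<equiv> A.newton_vec x"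

lemma Es_0_multiple: "\<exists>c. Es 0 v = c *s x"
  using B.E_rank1[of 0 x v] Es_0_x x_nonzero by auto

text \<open>
  The kernel of \<open>E r\<close> is stable under \<open>A\<close>. As \<open>A\<close> is irreducible tridiagonal on the lines
  \<open>Es i\<close>, an \<open>A\<close>-stable subspace containing \<open>x\<close> contains every \<open>Es i\<close>, hence everything;
  so \<open>x\<close> has a component in each eigenspace of \<open>A\<close>.
\<close>

lemma E_x_nonzero:
  assumes r: "r \<le> d"
  shows "E r x \<noteq> 0"
proof
  assume E0: "E r x = 0"
  have *: "i \<le> d \<Longrightarrow> E r (Es i v) = 0" for i v
  proof (induction i arbitrary: v rule: less_induct)
    case (less i)
    show ?case
    proof (cases i)
      case 0
      then show ?thesis using Es_0_multiple[of v] E0 r by (auto simp: A.E_simps)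
    next
      case (Suc k)
      then have k: "k \<le> d" "i \<le> d" using less by auto
      \<comment> \<open>\<open>Es i\<close> is spanned by the top component of \<open>A (Es k y)\<close>, all of whose other
        components are killed by \<open>E r\<close>.\<close>
      have "\<bar>int i - int k\<bar> = 1" using Suc by simp
      then obtain y where y: "Es i (A (Es k y)) \<noteq> 0"
        using Es_A_Es_nonzero[of i k] k by blast
      have "0 = E r (A (Es k y))"
        using r k less.IH[of k y] Suc by (simp add: A.E_T)
      also have "\<dots> = (\<Sum>j\<le>d. E r (Es j (A (Es k y))))"
        by (rule E_Es_expand[OF r])
      also have "\<dots> = E r (Es i (A (Es k y)))"
      proof (rule sum_single)
        fix j assume j: "j \<le> d" "j \<noteq> i"
        show "E r (Es j (A (Es k y))) = 0"
        proof (cases "j < i")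
          case True then show ?thesis using less.IH j by simp
        next
          case False
          then have "1 < \<bar>int j - int k\<bar>" using j Suc by simp
          then show ?thesis using Es_A_Es_eq_0 j k r by (simp add: A.E_simps)
        qed
      qed (use k in simp)
      finally have "E r (Es i (A (Es k y))) = 0" by simp
      moreover obtain c where "Es i v = c *s Es i (A (Es k y))"
        using B.E_rank1[OF k(2) y] by blast
      ultimately show ?thesis using r by (simp add: A.E_simps)
    qed
  qed
  obtain w where "E r w \<noteq> 0" using A.E_nonzero r by blast
  moreover have "E r w = (\<Sum>j\<le>d. E r (Es j w))"
    by (rule E_Es_expand[OF r])
  ultimately show False using * by simp
qed

text \<open>
  The next three lemmas say that \<open>u 0, \<dots>, u i\<close> is a basis of the \<open>i\<close>-th component of the
  flag of the \<open>Es\<close>: each application of \<open>A\<close> climbs exactly one step.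
\<close>

lemma Es_u_above: "i < r \<Longrightarrow> r \<le> d \<Longrightarrow> Es r (u i) = 0"
proof (induction i arbitrary: r)
  case 0
  then show ?case using B.E_E[of r 0 x] Es_0_x by (simp add: A.newton_vec_0)
next
  case (Suc i)
  have "Es r (A (Es j (u i))) = 0" if "j \<le> d" for j
  proof (cases "i < j")
    case True then show ?thesis using Suc that by (simp add: A.T_simps B.E_simps)
  next
    case False
    then have "1 < \<bar>int r - int j\<bar>" using Suc.prems by simp
    then show ?thesis using Es_A_Es_eq_0 that Suc by simp
  qed
  then have "Es r (A (u i)) = 0" using Es_A_expand[of r "u i"] Suc.prems by simp
  then show ?case using Suc by (simp add: A.newton_vec_Suc B.E_simps)
qed

lemma Es_u_nonzero: "i \<le> d \<Longrightarrow> Es i (u i) \<noteq> 0"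
proof (induction i)
  case 0
  then show ?case using Es_0_x x_nonzero by (simp add: A.newton_vec_0)
next
  case (Suc i)
  have "Es (Suc i) (A (u i)) = (\<Sum>j\<le>d. Es (Suc i) (A (Es j (u i))))"
    using Suc by (simp add: Es_A_expand)
  also have "\<dots> = Es (Suc i) (A (Es i (u i)))"
  proof (rule sum_single)
    fix j assume j: "j \<le> d" "j \<noteq> i"
    show "Es (Suc i) (A (Es j (u i))) = 0"
    proof (cases "i < j")
      case True then show ?thesis using Suc j Es_u_above by (simp add: A.T_simps B.E_simps)
    next
      case False
      then have "1 < \<bar>int (Suc i) - int j\<bar>" using j by simp
      then show ?thesis using Es_A_Es_eq_0 j Suc by simp
    qed
  qed (use Suc in simp)
  finally have eq: "Es (Suc i) (A (u i)) = Es (Suc i) (A (Es i (u i)))" .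
  obtain y where y: "Es (Suc i) (A (Es i y)) \<noteq> 0"
    using Es_A_Es_nonzero[of "Suc i" i] Suc.prems by auto
  obtain c where "Es i y = c *s Es i (u i)"
    using B.E_rank1[of i "u i" y] Suc by auto
  with y have "Es (Suc i) (A (Es i (u i))) \<noteq> 0"
    using Suc.prems by (auto simp: A.T_simps B.E_simps)
  with eq show ?case using Suc.prems
    by (simp add: A.newton_vec_Suc B.E_simps Es_u_above)
qed

lemma flag_span:
  "i \<le> d \<Longrightarrow> (\<And>r. i < r \<Longrightarrow> r \<le> d \<Longrightarrow> Es r v = 0) \<Longrightarrow> \<exists>c. v = (\<Sum>j\<le>i. c j *s u j)"
proof (induction i arbitrary: v)
  case 0
  have "v = Es 0 v"
    using B.sum_E[of v] sum_single[of 0 d "\<lambda>i. Es i v"] 0 by simp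
  then show ?case using Es_0_multiple[of v] by (auto simp: A.newton_vec_0)
next
  case (Suc i)
  obtain c where c: "Es (Suc i) v = c *s Es (Suc i) (u (Suc i))"
    using B.E_rank1[OF _ Es_u_nonzero] Suc.prems by blast
  have "Es r (v - c *s u (Suc i)) = 0" if "i < r" "r \<le> d" for r
    using Suc.prems(2)[of r] that c Es_u_above[of "Suc i" r]
    by (cases "r = Suc i") (auto simp: B.E_simps)
  then obtain c' where c': "v - c *s u (Suc i) = (\<Sum>j\<le>i. c' j *s u j)"
    using Suc.IH[of "v - c *s u (Suc i)"] Suc.prems by auto
  have "v = (\<Sum>j\<le>Suc i. (c'(Suc i := c)) j *s u j)"
    using c' by (simp add: algebra_simps)
  then show ?case by blast
qed

lemma E_B_u:
  assumes "r \<le> d"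
  shows "E r (B (u i)) = (\<Sum>j\<le>d. A.newton i j *s E r (B (E j x)))"
  using assms by (simp add: E_B_expand[of r "u i"] A.E_newton_vec B.T_simps A.E_simps)

lemma E_B_u_below:
  assumes "r < i - 1" "i \<le> d"
  shows "E r (B (u i)) = 0"
proof -
  have "A.newton i j *s E r (B (E j x)) = 0" if "j \<le> d" for j
  proof (cases "j < i")
    case True then show ?thesis by (simp add: A.newton_eq_0)
  next
    case False
    then have "1 < \<bar>int r - int j\<bar>" using assms by simp
    then show ?thesis using E_B_E_eq_0 assms that by simp
  qed
  then show ?thesis using assms by (subst E_B_u) (auto intro!: sum.neutral)
qed

text \<open>
  The up flag of the \<open>Es\<close> and the down flag of the \<open>E\<close> meet in lines. Expanding \<open>v\<close> in the \<open>u j\<close>,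
  the coefficients vanish one after the other, because the components \<open>E r (u j)\<close> form a triangular
  matrix whose diagonal entries \<open>\<tau>\<^sub>r(\<theta>\<^sub>r)\<close> are nonzero.
\<close>

lemma flag_intersection:
  assumes m: "m \<le> d" and up: "\<And>r. m < r \<Longrightarrow> r \<le> d \<Longrightarrow> Es r v = 0"
    and down: "\<And>r. r < m \<Longrightarrow> E r v = 0"
  shows "\<exists>c. v = c *s u m"
proof -
  obtain c where c: "v = (\<Sum>j\<le>m. c j *s u j)" using flag_span[OF m up] by blast
  have "r < m \<Longrightarrow> c r = 0" for r
  proof (induction r rule: less_induct)
    case (less r)
    have "0 = E r v" using down less by simp
    also have "\<dots> = (\<Sum>j\<le>m. (c j * A.newton j r) *s E r x)"
      using less m by (subst c) (simp add: A.E_simps A.E_newton_vec)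
    also have "\<dots> = (c r * A.newton r r) *s E r x"
    proof (rule sum_single)
      fix j assume "j \<le> m" "j \<noteq> r"
      then show "(c j * A.newton j r) *s E r x = 0"
        using less by (cases "j < r") (auto simp: A.newton_eq_0)
    qed (use less in simp)
    finally show ?case using E_x_nonzero[of r] A.newton_nonzero[of r r] less m by simp
  qed
  then have "v = c m *s u m"
    using c sum_single[of m m "\<lambda>j. c j *s u j"] by simp
  then show ?thesis by blast
qed

text \<open>
  The vector \<open>B (u i) - \<theta>s i *s u i\<close> has no component in \<open>Es r\<close> for \<open>r \<ge> i\<close>, and none in
  \<open>E r\<close> for \<open>r < i - 1\<close> because \<open>B\<close> is tridiagonal; so it lies on the line of \<open>u (i - 1)\<close>.
\<close>

lemma B_u:
  assumes i: "1 \<le> i" "i \<le> d"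
  shows "\<exists>c. B (u i) = \<theta>s i *s u i + c *s u (i - 1)"
proof -
  let ?v = "B (u i) - \<theta>s i *s u i"
  have up: "Es r ?v = 0" if "i - 1 < r" "r \<le> d" for r
    using that i Es_u_above[of i r] by (cases "r = i") (auto simp: B.E_simps B.E_T)
  have down: "E r ?v = 0" if "r < i - 1" for r
    using that i by (simp add: A.E_simps E_B_u_below A.E_newton_vec A.newton_eq_0)
  have "i - 1 \<le> d" using i by simp
  from flag_intersection[OF this up down] obtain c where "?v = c *s u (i - 1)" by blast
  then show ?thesis by (auto simp: algebra_simps)
qed

text \<open>
  The number \<open>u_coord i\<close> will turn out to be the trace of \<open>\<tau>\<^sub>i(A) Es\<^sub>0\<close>, which makes
  \<open>split_param\<close> the first split sequence. The formula also gives the value \<open>0\<close> at the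
  indices \<open>0\<close> and \<open>d + 1\<close>, where the recurrences below need it.
\<close>

definition u_coord :: "nat \<Rightarrow> 'a" where
  "u_coord i = (SOME c. Es 0 (u i) = c *s x)"

definition split_param :: "nat \<Rightarrow> 'a" where
  "split_param i = (\<theta>s 0 - \<theta>s i) * (u_coord i / u_coord (i - 1))"

lemma Es_0_u: "Es 0 (u i) = u_coord i *s x"
  unfolding u_coord_def using Es_0_multiple by (rule someI_ex)

lemma u_coord_eqI: "Es 0 (u i) = c *s x \<Longrightarrow> u_coord i = c"
  using Es_0_u[of i] x_nonzero by simp

lemma u_coord_0: "u_coord 0 = 1"
  by (rule u_coord_eqI) (simp add: A.newton_vec_0 Es_0_x)

lemma E_B_u_pred:
  assumes i: "1 \<le> i" "i \<le> d"
  shows "E (i - 1) (B (u i)) = A.newton i i *s E (i - 1) (B (E i x))"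
proof -
  have "E (i - 1) (B (u i)) = (\<Sum>j\<le>d. A.newton i j *s E (i - 1) (B (E j x)))"
    using i by (intro E_B_u) simp
  also have "\<dots> = A.newton i i *s E (i - 1) (B (E i x))"
  proof (rule sum_single)
    fix j assume j: "j \<le> d" "j \<noteq> i"
    show "A.newton i j *s E (i - 1) (B (E j x)) = 0"
    proof (cases "j < i")
      case False
      then have "1 < \<bar>int (i - 1) - int j\<bar>" using j i by auto
      then show ?thesis using E_B_E_eq_0[of "i - 1" j] j i by simp
    qed (simp add: A.newton_eq_0)
  qed (use i in simp)
  finally show ?thesis .
qed

lemma E_B_E_x_nonzero:
  assumes "i \<le> d" "j \<le> d" "\<bar>int i - int j\<bar> = 1"
  shows "E i (B (E j x)) \<noteq> 0"
proof
  assume 0: "E i (B (E j x)) = 0"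
  obtain v where v: "E i (B (E j v)) \<noteq> 0" using E_B_E_nonzero assms by blast
  obtain c where "E j v = c *s E j x" using A.E_rank1 E_x_nonzero assms by blast
  then show False using v 0 assms by (simp add: B.T_simps A.E_simps)
qed

text \<open>
  The coefficient of \<open>u (i - 1)\<close> in \<open>B (u i)\<close> is computed twice: in \<open>E (i - 1)\<close>, which relates it
  to the entry of \<open>B\<close> above the diagonal and shows that it is nonzero, and in \<open>Es 0\<close>, which gives
  the formula for the split sequence.
\<close>

lemma split_param_aux:
  assumes i: "1 \<le> i" "i \<le> d" and c: "B (u i) = \<theta>s i *s u i + c *s u (i - 1)"
  shows "A.newton i i *s E (i - 1) (B (E i x)) = (c * A.newton (i - 1) (i - 1)) *s E (i - 1) x"
    and "c \<noteq> 0"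
    and "c * u_coord (i - 1) = (\<theta>s 0 - \<theta>s i) * u_coord i"
proof -
  show *: "A.newton i i *s E (i - 1) (B (E i x)) = (c * A.newton (i - 1) (i - 1)) *s E (i - 1) x"
    using E_B_u_pred[OF i] i by (simp add: c A.E_simps A.E_newton_vec A.newton_eq_0)
  have "E (i - 1) (B (E i x)) \<noteq> 0"
    by (rule E_B_E_x_nonzero) (use i in auto)
  then show "c \<noteq> 0" using * A.newton_nonzero[of i i] i by auto
  have "(\<theta>s 0 * u_coord i) *s x = (\<theta>s i * u_coord i + c * u_coord (i - 1)) *s x"
    using arg_cong[OF c, of "Es 0"] i by (simp add: B.E_T B.E_simps Es_0_u A.scale_left_distrib)
  then have "\<theta>s 0 * u_coord i = \<theta>s i * u_coord i + c * u_coord (i - 1)"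
    by (rule A.scale_right_imp_eq[OF x_nonzero])
  then show "c * u_coord (i - 1) = (\<theta>s 0 - \<theta>s i) * u_coord i"
    by (simp add: algebra_simps)
qed

lemma u_coord_nonzero: "i \<le> d \<Longrightarrow> u_coord i \<noteq> 0"
proof (induction i)
  case (Suc i)
  then obtain c where c: "B (u (Suc i)) = \<theta>s (Suc i) *s u (Suc i) + c *s u i"
    using B_u[of "Suc i"] by auto
  show ?case
    using split_param_aux[of "Suc i" c] c Suc by auto
qed (simp add: u_coord_0)

lemma
  assumes i: "1 \<le> i" "i \<le> d"
  shows B_u_split: "B (u i) = \<theta>s i *s u i + split_param i *s u (i - 1)"
    and split_param_nonzero: "split_param i \<noteq> 0"
    and E_B_E_x: "A.newton i i *s E (i - 1) (B (E i x)) =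
      (split_param i * A.newton (i - 1) (i - 1)) *s E (i - 1) x"
proof -
  obtain c where c: "B (u i) = \<theta>s i *s u i + c *s u (i - 1)"
    using B_u[OF i] by blast
  have "u_coord (i - 1) \<noteq> 0" using u_coord_nonzero i by simp
  then have "split_param i = c"
    using split_param_aux(3)[OF i c] by (simp add: split_param_def field_simps)
  then show "B (u i) = \<theta>s i *s u i + split_param i *s u (i - 1)" "split_param i \<noteq> 0"
    "A.newton i i *s E (i - 1) (B (E i x)) = (split_param i * A.newton (i - 1) (i - 1)) *s E (i - 1) x"
    using c split_param_aux[OF i c] by simp_all
qed

lemma split_param_0: "split_param 0 = 0"
  by (simp add: split_param_def)

lemma split_param_above: "split_param (Suc d) = 0"
proof -
  have "u_coord (Suc d) = 0"
    by (rule u_coord_eqI) (simp add: A.newton_vec_above B.E_simps)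
  then show ?thesis by (simp add: split_param_def)
qed

text \<open>
  The diagonal entries of \<open>B\<close> in an eigenbasis of \<open>A\<close> do not depend on the vector \<open>x\<close> nor on the
  orderings, whereas the right-hand side is written in the split sequence of one particular ordering.
  Comparing such formulas therefore relates the split sequences of different orderings. The
  formula is the \<open>E i\<close>-component of the recurrence for \<open>B (u i)\<close>, divided by \<open>\<tau>\<^sub>i(\<theta>\<^sub>i)\<close>.
  At \<open>i = 0\<close> and at \<open>i = d\<close> a denominator is meaningless, but then its numerator vanishes.
\<close>

lemma diagonal_entry:
  assumes i: "i \<le> d" and a: "E i (B (E i x)) = a *s E i x"
  shows "a = \<theta>s i + split_param i / (\<theta> i - \<theta> (i - 1)) - split_param (Suc i) / (\<theta> (Suc i) - \<theta> i)"
proof -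
  let ?n = "A.newton i i"
  have n: "?n \<noteq> 0" using A.newton_nonzero i by simp
  have Ex: "E i x \<noteq> 0" using E_x_nonzero i by simp
  have "E i (B (u i)) = (\<theta>s i * ?n + split_param i * A.newton (i - 1) i) *s E i x"
  proof (cases i)
    case 0
    have "B x = \<theta>s 0 *s x" using B.T_E[of 0 x] Es_0_x by simp
    then show ?thesis
      using 0 by (simp add: A.newton_vec_0 A.E_simps split_param_0 A.newton_def)
  next
    case (Suc k)
    then show ?thesis
      using B_u_split[of i] i by (simp add: A.E_simps A.E_newton_vec A.scale_left_distrib)
  qed
  also have "split_param i * A.newton (i - 1) i = ?n * (split_param i / (\<theta> i - \<theta> (i - 1)))"
  proof (cases i)
    case 0 then show ?thesis by (simp add: split_param_0)
  next
    case (Suc k)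
    then show ?thesis using A.\<theta>_neq[of i k] i by (simp add: A.newton_Suc)
  qed
  finally have 1: "E i (B (u i)) =
    (\<theta>s i * ?n + ?n * (split_param i / (\<theta> i - \<theta> (i - 1)))) *s E i x" .
  \<comment> \<open>As \<open>u i\<close> has no component below \<open>E i\<close>, only \<open>E i\<close> and \<open>E (Suc i)\<close> contribute.\<close>
  have 2: "E i (B (u i)) = (?n * a + ?n * (split_param (Suc i) / (\<theta> (Suc i) - \<theta> i))) *s E i x"
  proof (cases "i = d")
    case True
    have "E i (B (u i)) = (\<Sum>j\<le>d. A.newton i j *s E i (B (E j x)))"
      using i by (rule E_B_u)
    also have "\<dots> = ?n *s E i (B (E i x))"
      by (rule sum_single) (use i True in \<open>auto simp: A.newton_eq_0\<close>)
    finally show ?thesis using True a split_param_above by simp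
  next
    case False
    then have Si: "Suc i \<le> d" using i by simp
    have "E i (B (u i)) = (\<Sum>j\<le>d. A.newton i j *s E i (B (E j x)))"
      using i by (rule E_B_u)
    also have "\<dots> = (\<Sum>j\<in>{i, Suc i}. A.newton i j *s E i (B (E j x)))"
    proof (rule sum.mono_neutral_right)
      show "\<forall>j\<in>{..d} - {i, Suc i}. A.newton i j *s E i (B (E j x)) = 0"
      proof
        fix j assume j: "j \<in> {..d} - {i, Suc i}"
        show "A.newton i j *s E i (B (E j x)) = 0"
        proof (cases "j < i")
          case False
          then have "1 < \<bar>int i - int j\<bar>" using j by auto
          then show ?thesis using E_B_E_eq_0[of i j] j i by simp
        qed (simp add: A.newton_eq_0)
      qed
    qed (use Si in auto)
    also have "\<dots> = (?n * a) *s E i x + A.newton i (Suc i) *s E i (B (E (Suc i) x))"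
      by (simp add: a)
    also have "A.newton i (Suc i) *s E i (B (E (Suc i) x)) =
        (1 / (\<theta> (Suc i) - \<theta> i)) *s (A.newton (Suc i) (Suc i) *s E i (B (E (Suc i) x)))"
      using A.\<theta>_neq[of "Suc i" i] Si by (simp add: A.newton_Suc)
    also have "\<dots> = (?n * (split_param (Suc i) / (\<theta> (Suc i) - \<theta> i))) *s E i x"
      using E_B_E_x[of "Suc i"] Si by (simp add: mult.commute)
    finally show ?thesis by (simp add: A.scale_left_distrib)
  qed
  have "?n * a + ?n * (split_param (Suc i) / (\<theta> (Suc i) - \<theta> i)) =
      \<theta>s i * ?n + ?n * (split_param i / (\<theta> i - \<theta> (i - 1)))"
    using 1 2 Ex by simp
  then have "?n * (a + split_param (Suc i) / (\<theta> (Suc i) - \<theta> i)) =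
      ?n * (\<theta>s i + split_param i / (\<theta> i - \<theta> (i - 1)))"
    by (simp add: algebra_simps)
  then have "a + split_param (Suc i) / (\<theta> (Suc i) - \<theta> i) =
      \<theta>s i + split_param i / (\<theta> i - \<theta> (i - 1))"
    using n by (simp only: mult_cancel_left) simp
  then show ?thesis by (simp add: algebra_simps)
qed

end

section \<open>The switching operator\<close>

text \<open>
  Three orderings of one Leonard system meet here: the given one, \<open>rev\<close> with the eigenvalues of
  \<open>A\<close> reversed, whose split sequence is the second split sequence, and \<open>opp\<close> with those of \<open>B\<close>
  reversed, based at a generator \<open>y\<close> of \<open>Es d\<close>.
\<close>

locale switching =
  leonard_vector smul d A E \<theta> B Es \<theta>s x +
  rev: leonard_vector smul d A "\<lambda>i. E (d - i)" "\<lambda>i. \<theta> (d - i)" B Es \<theta>s x +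
  opp: leonard_vector smul d A E \<theta> B "\<lambda>i. Es (d - i)" "\<lambda>i. \<theta>s (d - i)" y
  for smul :: "'k::field \<Rightarrow> 'v::ab_group_add \<Rightarrow> 'v" (infixr "*s" 75)
    and d A E \<theta> B Es \<theta>s x y
begin

text \<open>
  Both sides describe the same diagonal entries of \<open>B\<close>. The two formulas for the \<open>i\<close>-th entry
  have the same shape, so the equality propagates from \<open>i\<close> to \<open>i + 1\<close>.
\<close>

lemma opp_split_param: "i \<le> d \<Longrightarrow> opp.split_param i = rev.split_param (Suc d - i)"
proof (induction i)
  case 0
  then show ?case by (simp add: opp.split_param_0 rev.split_param_above)
next
  case (Suc i)
  then have i: "i \<le> d" by simp
  obtain a where a: "E i (B (E i x)) = a *s E i x"
    using A.E_rank1[OF i E_x_nonzero[OF i]] by blast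
  obtain c where "E i y = c *s E i x"
    using A.E_rank1[OF i E_x_nonzero[OF i]] by blast
  \<comment> \<open>The diagonal entry \<open>a\<close> is the same whether it is read off on \<open>x\<close> or on \<open>y\<close>.\<close>
  then have a': "E i (B (E i y)) = a *s E i y"
    using a i by (simp add: A.E_simps B.T_simps mult.commute)
  have 1: "a = \<theta>s (d - i) + opp.split_param i / (\<theta> i - \<theta> (i - 1))
      - opp.split_param (Suc i) / (\<theta> (Suc i) - \<theta> i)"
    by (rule opp.diagonal_entry[OF i a'])
  have "a = \<theta>s (d - i) + rev.split_param (d - i) / (\<theta> (d - (d - i)) - \<theta> (d - (d - i - 1)))
      - rev.split_param (Suc (d - i)) / (\<theta> (d - Suc (d - i)) - \<theta> (d - (d - i)))"
    by (rule rev.diagonal_entry) (use a i in simp_all)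
  moreover have "d - (d - i - 1) = Suc i" "d - Suc (d - i) = i - 1" "Suc (d - i) = Suc d - i"
    using Suc.prems by auto
  ultimately have 2: "a = \<theta>s (d - i) + rev.split_param (d - i) / (\<theta> i - \<theta> (Suc i))
      - rev.split_param (Suc d - i) / (\<theta> (i - 1) - \<theta> i)"
    using i by simp
  have neg: "p / (\<theta> k - \<theta> l) = - (p / (\<theta> l - \<theta> k))" for p k l
    by (metis minus_diff_eq divide_minus_right)
  have "opp.split_param (Suc i) / (\<theta> (Suc i) - \<theta> i) = rev.split_param (d - i) / (\<theta> (Suc i) - \<theta> i)"
    using 1 2 Suc.IH[OF i] neg[of _ i "Suc i"] neg[of _ "i - 1" i] by auto
  then show ?case using A.\<theta>_neq[of "Suc i" i] Suc.prems by auto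
qed

definition switch_coeff :: "nat \<Rightarrow> 'k" where
  "switch_coeff r = (\<Prod>h<r. rev.split_param (d - h)) / (\<Prod>h=1..r. split_param h)"

definition switch :: "'v \<Rightarrow> 'v" where
  "switch v = (\<Sum>r\<le>d. switch_coeff r *s E r v)"

lemma E_switch: "r \<le> d \<Longrightarrow> E r (switch v) = switch_coeff r *s E r v"
  by (simp add: switch_def A.E_sum)

lemma switch_coeff_nonzero: "r \<le> d \<Longrightarrow> switch_coeff r \<noteq> 0"
  using split_param_nonzero rev.split_param_nonzero by (auto simp: switch_coeff_def)

lemma switch_coeff_Suc:
  "switch_coeff (Suc r) = switch_coeff r * (rev.split_param (d - r) / split_param (Suc r))"
  by (simp add: switch_coeff_def)

text \<open>
  The heart of the matter: up to a scalar the switching operator sends \<open>x\<close> to \<open>y\<close>. Writing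
  \<open>E r y = k\<^sub>r *s E r x\<close>, the entry of \<open>B\<close> from \<open>E (r + 1)\<close> to \<open>E r\<close> is expressed by
  \<open>split_param (r + 1)\<close> when computed on \<open>x\<close> and by \<open>opp.split_param (r + 1)\<close> when computed on
  \<open>y\<close>; hence \<open>k\<^sub>r\<^sub>+\<^sub>1 / k\<^sub>r\<close> is the quotient of the second by the first, which is the
  quotient that defines the switching element.
\<close>

lemma E_y: "\<exists>c. c \<noteq> 0 \<and> (\<forall>r\<le>d. E r y = (c * switch_coeff r) *s E r x)"
proof -
  obtain c where c: "E 0 y = c *s E 0 x"
    using A.E_rank1[OF _ E_x_nonzero] by blast
  have "r \<le> d \<Longrightarrow> E r y = (c * switch_coeff r) *s E r x" for r
  proof (induction r)
    case 0
    then show ?case using c by (simp add: switch_coeff_def)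
  next
    case (Suc r)
    let ?z = "E r (B (E (Suc r) x))" and ?n = "A.newton (Suc r) (Suc r)" and ?m = "A.newton r r"
    have z: "?n *s ?z = (split_param (Suc r) * ?m) *s E r x"
      using E_B_E_x[of "Suc r"] Suc.prems by simp
    obtain k where k: "E (Suc r) y = k *s E (Suc r) x"
      using A.E_rank1[OF Suc.prems E_x_nonzero[OF Suc.prems]] by blast
    have "(k * split_param (Suc r) * ?m) *s E r x = k *s (?n *s ?z)"
      by (simp add: z)
    also have "\<dots> = ?n *s E r (B (E (Suc r) y))"
      using k Suc.prems by (simp add: B.T_simps A.E_simps mult.commute)
    also have "\<dots> = (rev.split_param (d - r) * ?m) *s E r y"
      using opp.E_B_E_x[of "Suc r"] Suc.prems opp_split_param[of "Suc r"] by simp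
    also have "\<dots> = (rev.split_param (d - r) * ?m * (c * switch_coeff r)) *s E r x"
      using Suc by simp
    finally have "k * split_param (Suc r) * ?m = rev.split_param (d - r) * ?m * (c * switch_coeff r)"
      using E_x_nonzero[of r] Suc.prems by simp
    then have "k = c * switch_coeff (Suc r)"
      using A.newton_nonzero[of r r] split_param_nonzero[of "Suc r"] Suc.prems
      by (simp add: switch_coeff_Suc field_simps)
    then show ?case using k by simp
  qed
  moreover have "c \<noteq> 0" using c opp.E_x_nonzero[of 0] by auto
  ultimately show ?thesis by blast
qed

lemma switch_hom: "module_hom smul smul switch"
proof
  show "switch (v + w) = switch v + switch w" for v w
    by (rule A.E_eqI) (simp add: E_switch A.E_simps A.scale_right_distrib)
  show "switch (c *s v) = c *s switch v" for c v
    by (rule A.E_eqI) (simp add: E_switch A.E_simps mult.commute)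
qed

lemma switch_inj: "switch v = switch w \<Longrightarrow> v = w"
  by (rule A.E_eqI) (metis E_switch A.scale_left_imp_eq switch_coeff_nonzero)

lemma switch_surj: "\<exists>w. switch w = v"
proof
  show "switch (\<Sum>r\<le>d. (1 / switch_coeff r) *s E r v) = v"
    by (rule A.E_eqI) (simp add: E_switch A.E_sum switch_coeff_nonzero)
qed

text \<open>
  The switching operator commutes with \<open>A\<close>, so it carries \<open>\<tau>\<^sub>i(A) x\<close> to a multiple of
  \<open>\<tau>\<^sub>i(A) y\<close>.
\<close>

lemma switch_newton_vec: "\<exists>c. c \<noteq> 0 \<and> (\<forall>i. opp.u i = c *s switch (u i))"
proof -
  obtain c where c: "c \<noteq> 0" "\<And>r. r \<le> d \<Longrightarrow> E r y = (c * switch_coeff r) *s E r x"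
    using E_y by blast
  have "opp.u i = c *s switch (u i)" for i
    by (rule A.E_eqI) (simp add: A.E_newton_vec A.E_simps E_switch c(2) mult_ac)
  with c(1) show ?thesis by blast
qed

text \<open>
  The two split bases \<open>u\<close> and \<open>opp.u\<close> are adapted to the up flag and the down flag of the \<open>Es\<close>.
  An equivalence rather than an implication is what makes the flags equal, not only included.
\<close>

lemma switch_flag:
  assumes i: "i \<le> d"
  shows "(\<forall>r\<le>d. i < r \<longrightarrow> Es r v = 0) \<longleftrightarrow> (\<forall>r<d - i. Es r (switch v) = 0)"
proof -
  obtain c where c: "c \<noteq> 0" "\<And>i. opp.u i = c *s switch (u i)"
    using switch_newton_vec by blast
  show ?thesis
  proof
    assume "\<forall>r\<le>d. i < r \<longrightarrow> Es r v = 0"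
    then obtain k where k: "v = (\<Sum>j\<le>i. k j *s u j)"
      using flag_span[OF i, of v] by blast
    show "\<forall>r<d - i. Es r (switch v) = 0"
    proof (intro allI impI)
      fix r assume r: "r < d - i"
      have "Es r (opp.u j) = 0" if "j \<le> i" for j
        using opp.Es_u_above[of j "d - r"] that r i by simp
      then have "Es r (switch (u j)) = 0" if "j \<le> i" for j
        using that c r by (simp add: B.E_simps)
      then show "Es r (switch v) = 0"
        using r k by (simp add: module_hom.sum[OF switch_hom] module_hom.scale[OF switch_hom] B.E_simps)
    qed
  next
    assume v: "\<forall>r<d - i. Es r (switch v) = 0"
    have "Es (d - r) (switch v) = 0" if "i < r" "r \<le> d" for r
      using v that by simp
    then obtain k where k: "switch v = (\<Sum>j\<le>i. k j *s opp.u j)"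
      using opp.flag_span[OF i, of "switch v"] by blast
    also have "\<dots> = switch (\<Sum>j\<le>i. (k j * c) *s u j)"
      by (simp add: c(2) module_hom.sum[OF switch_hom] module_hom.scale[OF switch_hom])
    finally have "v = (\<Sum>j\<le>i. (k j * c) *s u j)" by (rule switch_inj)
    then show "\<forall>r\<le>d. i < r \<longrightarrow> Es r v = 0"
      by (simp add: B.E_simps Es_u_above)
  qed
qed

text \<open>
  An operator that preserves every \<open>E i\<close> is determined by its value at \<open>x\<close>, since \<open>x\<close> has a
  component in each \<open>E i\<close>; and the value at \<open>x\<close> is confined to the line of \<open>y\<close>.
\<close>

lemma switch_unique:
  assumes X: "module_hom smul smul X"
    and diag: "\<And>i j v. i \<le> d \<Longrightarrow> j \<le> d \<Longrightarrow> i \<noteq> j \<Longrightarrow> E i (X (E j v)) = 0"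
    and x: "\<And>r. r < d \<Longrightarrow> Es r (X x) = 0"
  shows "\<exists>c. \<forall>v. X v = c *s switch v"
proof -
  have EX: "E i (X v) = E i (X (E i v))" if i: "i \<le> d" for i v
  proof -
    have "E i (X v) = E i (X (\<Sum>j\<le>d. E j v))" by (simp only: A.sum_E)
    also have "\<dots> = (\<Sum>j\<le>d. E i (X (E j v)))"
      by (simp only: module_hom.sum[OF X] A.E_simps[OF i])
    also have "\<dots> = E i (X (E i v))"
      by (rule sum_single) (use i diag in auto)
    finally show ?thesis .
  qed
  obtain k where k: "k \<noteq> 0" "\<And>r. r \<le> d \<Longrightarrow> E r y = (k * switch_coeff r) *s E r x"
    using E_y by blast
  have "Es (d - r) (X x) = 0" if "0 < r" "r \<le> d" for r
    using x that by simp
  then obtain c where c: "X x = c *s y"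
    using opp.flag_span[of 0 "X x"] by (auto simp: A.newton_vec_0)
  have "X v = (c * k) *s switch v" for v
  proof (rule A.E_eqI)
    fix i assume i: "i \<le> d"
    obtain b where b: "E i v = b *s E i x"
      using A.E_rank1[OF i E_x_nonzero[OF i]] by blast
    have "E i (X v) = b *s E i (X (E i x))"
      using i by (simp add: EX[OF i, of v] b module_hom.scale[OF X] A.E_simps)
    also have "\<dots> = b *s E i (X x)" using EX[OF i, of x] by simp
    also have "\<dots> = E i ((c * k) *s switch v)"
      using i by (simp add: c A.E_simps k E_switch b mult_ac)
    finally show "E i (X v) = E i ((c * k) *s switch v)" .
  qed
  then show ?thesis by blast
qed

end

section \<open>The simple module of a matrix algebra\<close>

locale matrix_algebra_module = matrix_algebra scale d \<rho> + simple_left_module act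
  for scale :: "'k::field \<Rightarrow> 'a::ring_1 \<Rightarrow> 'a" and d :: nat and \<rho> :: "'a \<Rightarrow> 'k mat"
    and act :: "'a \<Rightarrow> 'v::ab_group_add \<Rightarrow> 'v"
begin

definition smul :: "'k \<Rightarrow> 'v \<Rightarrow> 'v" (infixr "*v" 75) where
  "c *v v = act (scale c 1) v"

lemma act_scale: "act (scale c x) v = c *v act x v"
  by (simp add: smul_def scale_mult_left flip: act_mult)

lemma act_smul: "act x (c *v v) = c *v act x v"
  by (simp add: smul_def scale_mult_left scale_mult_right flip: act_mult)

sublocale V: vector_space smul
proof
  show "a *v (x + y) = a *v x + a *v y" for a x y
    by (simp add: smul_def act_add_right)
  show "(a + b) *v x = a *v x + b *v x" for a b x
    by (simp add: smul_def act_add_left scale_left_distrib)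
  show "a *v b *v x = (a * b) *v x" for a b x
    by (simp add: smul_def scale_mult_left flip: act_mult)
  show "1 *v x = x" for x
    by (simp add: smul_def act_one)
qed

lemma act_hom: "module_hom smul smul (act x)"
  by unfold_locales (simp_all add: act_add_right act_smul)

lemmas act_simps = module_hom.zero[OF act_hom] module_hom.diff[OF act_hom]
  module_hom.sum[OF act_hom] act_add_right act_smul

lemma act_sum_left: "act (\<Sum>i\<in>I. f i) v = (\<Sum>i\<in>I. act (f i) v)"
proof -
  have "additive (\<lambda>x. act x v)" by (simp add: additive_def act_add_left)
  then show ?thesis by (rule additive.sum)
qed

lemma act_zero_left: "act 0 v = 0"
  using act_sum_left[of "\<lambda>_. 0" "{}"] by simp

lemma \<rho>_carrier: "\<rho> x \<in> carrier_mat (d + 1) (d + 1)"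
  using iso_bij by (auto simp: bij_betw_def)

lemma \<rho>_eqI:
  assumes "\<And>i j. i \<le> d \<Longrightarrow> j \<le> d \<Longrightarrow> \<rho> x $$ (i, j) = \<rho> y $$ (i, j)"
  shows "x = y"
proof -
  have "\<rho> x = \<rho> y"
    using \<rho>_carrier[of x] \<rho>_carrier[of y] assms by (intro eq_matI) auto
  then show ?thesis using iso_bij by (auto simp: bij_betw_def inj_def)
qed

lemma \<rho>_sum:
  assumes "i \<le> d" "j \<le> d"
  shows "\<rho> (\<Sum>l\<in>I. f l) $$ (i, j) = (\<Sum>l\<in>I. \<rho> (f l) $$ (i, j))"
proof -
  have "(\<rho> x + \<rho> y) $$ (i, j) = \<rho> x $$ (i, j) + \<rho> y $$ (i, j)" for x y
    using \<rho>_carrier[of y] assms by (intro index_add_mat) auto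
  then have "additive (\<lambda>x. \<rho> x $$ (i, j))"
    by (simp add: additive_def iso_add)
  then show ?thesis by (rule additive.sum)
qed

lemma \<rho>_scale: "i \<le> d \<Longrightarrow> j \<le> d \<Longrightarrow> \<rho> (scale c x) $$ (i, j) = c * \<rho> x $$ (i, j)"
  using \<rho>_carrier[of x] by (simp add: iso_scale)

lemma \<rho>_mult:
  assumes "i \<le> d" "j \<le> d"
  shows "\<rho> (x * y) $$ (i, j) = (\<Sum>l\<le>d. \<rho> x $$ (i, l) * \<rho> y $$ (l, j))"
  using \<rho>_carrier[of x] \<rho>_carrier[of y] assms
  by (simp add: iso_mult scalar_prod_def atLeast0LessThan lessThan_Suc_atMost)

text \<open>
  The matrix units yield coordinates on the module: a nonzero vector \<open>w\<close> in the image of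
  \<open>matrix_unit k k\<close> gives the basis of all \<open>matrix_unit j k\<close> applied to \<open>w\<close>, in which \<open>x\<close> acts
  by the matrix \<open>\<rho> x\<close>.
\<close>

definition matrix_unit :: "nat \<Rightarrow> nat \<Rightarrow> 'a" where
  "matrix_unit i j = inv_into UNIV \<rho> (mat (d + 1) (d + 1) (\<lambda>p. if p = (i, j) then 1 else 0))"

lemma \<rho>_matrix_unit:
  assumes "a \<le> d" "b \<le> d"
  shows "\<rho> (matrix_unit i j) $$ (a, b) = (if a = i \<and> b = j then 1 else 0)"
proof -
  have "mat (d + 1) (d + 1) (\<lambda>p. if p = (i, j) then 1 else 0) \<in> range \<rho>"
    using iso_bij by (simp add: bij_betw_def)
  then have "\<rho> (matrix_unit i j) = mat (d + 1) (d + 1) (\<lambda>p. if p = (i, j) then 1 else 0)"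
    unfolding matrix_unit_def by (rule f_inv_into_f)
  then show ?thesis using assms by simp
qed

lemma mult_matrix_unit:
  assumes "j \<le> d" "k \<le> d"
  shows "x * matrix_unit j k = (\<Sum>i\<le>d. scale (\<rho> x $$ (i, j)) (matrix_unit i k))"
proof (rule \<rho>_eqI)
  fix a b assume ab: "a \<le> d" "b \<le> d"
  have "\<rho> (x * matrix_unit j k) $$ (a, b) =
      (\<Sum>l\<le>d. if l = j then \<rho> x $$ (a, l) * (if b = k then 1 else 0) else 0)"
    unfolding \<rho>_mult[OF ab] by (intro sum.cong) (auto simp: \<rho>_matrix_unit ab)
  also have "\<dots> = \<rho> x $$ (a, j) * (if b = k then 1 else 0)" using assms by simp
  also have "\<dots> = (\<Sum>i\<le>d. if i = a then \<rho> x $$ (i, j) * (if b = k then 1 else 0) else 0)"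
    using ab by simp
  also have "\<dots> = \<rho> (\<Sum>i\<le>d. scale (\<rho> x $$ (i, j)) (matrix_unit i k)) $$ (a, b)"
    unfolding \<rho>_sum[OF ab] by (intro sum.cong) (auto simp: \<rho>_matrix_unit \<rho>_scale ab)
  finally show "\<rho> (x * matrix_unit j k) $$ (a, b) =
    \<rho> (\<Sum>i\<le>d. scale (\<rho> x $$ (i, j)) (matrix_unit i k)) $$ (a, b)" .
qed

lemma sum_matrix_unit: "(\<Sum>i\<le>d. matrix_unit i i) = 1"
proof (rule \<rho>_eqI)
  fix a b assume ab: "a \<le> d" "b \<le> d"
  have "\<rho> (\<Sum>i\<le>d. matrix_unit i i) $$ (a, b) = (\<Sum>i\<le>d. if i = a then if a = b then 1 else 0 else 0)"
    unfolding \<rho>_sum[OF ab] by (intro sum.cong) (auto simp: \<rho>_matrix_unit ab)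
  then show "\<rho> (\<Sum>i\<le>d. matrix_unit i i) $$ (a, b) = \<rho> 1 $$ (a, b)"
    using ab by (simp add: iso_one)
qed

definition matrix_basis :: "(nat \<Rightarrow> 'v) \<Rightarrow> bool" where
  "matrix_basis b \<longleftrightarrow>
    (\<forall>x. \<forall>j\<le>d. act x (b j) = (\<Sum>i\<le>d. (\<rho> x $$ (i, j)) *v b i)) \<and>
    (\<forall>c. (\<Sum>j\<le>d. c j *v b j) = 0 \<longrightarrow> (\<forall>j\<le>d. c j = 0)) \<and>
    (\<forall>v. \<exists>c. v = (\<Sum>j\<le>d. c j *v b j))"

lemma
  assumes "matrix_basis b"
  shows matrix_basis_act: "j \<le> d \<Longrightarrow> act x (b j) = (\<Sum>i\<le>d. (\<rho> x $$ (i, j)) *v b i)"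
    and matrix_basis_indep: "(\<Sum>j\<le>d. c j *v b j) = 0 \<Longrightarrow> j \<le> d \<Longrightarrow> c j = 0"
    and matrix_basis_span: "\<exists>c. v = (\<Sum>j\<le>d. c j *v b j)"
  using assms unfolding matrix_basis_def by blast+

lemma act_combination:
  assumes "\<forall>x. \<forall>j\<le>d. act x (b j) = (\<Sum>i\<le>d. (\<rho> x $$ (i, j)) *v b i)"
  shows "act x (\<Sum>j\<le>d. c j *v b j) = (\<Sum>i\<le>d. (\<Sum>j\<le>d. \<rho> x $$ (i, j) * c j) *v b i)"
proof -
  have "act x (\<Sum>j\<le>d. c j *v b j) = (\<Sum>j\<le>d. \<Sum>i\<le>d. (\<rho> x $$ (i, j) * c j) *v b i)"
    using assms by (simp add: act_simps V.scale_sum_right mult.commute)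
  also have "\<dots> = (\<Sum>i\<le>d. \<Sum>j\<le>d. (\<rho> x $$ (i, j) * c j) *v b i)" by (rule sum.swap)
  finally show ?thesis by (simp add: V.scale_sum_left)
qed

text \<open>
  The span of the vectors \<open>b j\<close> is a nonzero submodule, hence everything by simplicity; applying
  \<open>matrix_unit k l\<close> to a combination extracts its coefficient of index \<open>l\<close>, which gives
  independence.
\<close>

lemma ex_matrix_basis: "\<exists>b. matrix_basis b"
proof -
  obtain v0 :: 'v where v0: "v0 \<noteq> 0" using nonzero by blast
  have "v0 = (\<Sum>i\<le>d. act (matrix_unit i i) v0)"
    by (simp add: act_one sum_matrix_unit flip: act_sum_left)
  with v0 obtain k where k: "k \<le> d" "act (matrix_unit k k) v0 \<noteq> 0"
    by (metis (no_types, lifting) atMost_iff sum.neutral)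
  define b where "b j = act (matrix_unit j k) v0" for j
  have act: "\<forall>x. \<forall>j\<le>d. act x (b j) = (\<Sum>i\<le>d. (\<rho> x $$ (i, j)) *v b i)"
  proof (intro allI impI)
    fix x j assume "j \<le> d"
    then show "act x (b j) = (\<Sum>i\<le>d. (\<rho> x $$ (i, j)) *v b i)"
      using k by (simp add: b_def mult_matrix_unit act_sum_left act_scale flip: act_mult)
  qed
  have indep: "c l = 0" if c: "(\<Sum>j\<le>d. c j *v b j) = 0" and l: "l \<le> d" for c l
  proof -
    have "0 = act (matrix_unit k l) (\<Sum>j\<le>d. c j *v b j)"
      using c by (simp add: act_simps)
    also have "\<dots> = (\<Sum>i\<le>d. (\<Sum>j\<le>d. \<rho> (matrix_unit k l) $$ (i, j) * c j) *v b i)"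
      by (rule act_combination[OF act])
    also have "\<dots> = (\<Sum>i\<le>d. if i = k then c l *v b i else 0)"
    proof (intro sum.cong refl)
      fix i assume i: "i \<in> {..d}"
      have "(\<Sum>j\<le>d. \<rho> (matrix_unit k l) $$ (i, j) * c j) =
          (\<Sum>j\<le>d. if j = l then if i = k then c j else 0 else 0)"
        using i by (intro sum.cong) (auto simp: \<rho>_matrix_unit)
      then show "(\<Sum>j\<le>d. \<rho> (matrix_unit k l) $$ (i, j) * c j) *v b i =
          (if i = k then c l *v b i else 0)"
        using l by simp
    qed
    also have "\<dots> = c l *v b k" using k by simp
    finally show "c l = 0" using k by (simp add: b_def)
  qed
  let ?W = "range (\<lambda>c. \<Sum>j\<le>d. c j *v b j)"
  have "submodule act ?W"
    unfolding submodule_def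
  proof (intro conjI ballI allI)
    show "0 \<in> ?W" by (rule range_eqI[of _ _ "\<lambda>_. 0"]) simp
    fix v assume "v \<in> ?W"
    then obtain c where c: "v = (\<Sum>j\<le>d. c j *v b j)" by blast
    show "act x v \<in> ?W" for x
      unfolding c act_combination[OF act] by (rule rangeI)
    fix w assume "w \<in> ?W"
    then obtain c' where c': "w = (\<Sum>j\<le>d. c' j *v b j)" by blast
    show "v + w \<in> ?W"
      by (rule range_eqI[of _ _ "\<lambda>j. c j + c' j"])
        (simp add: c c' V.scale_left_distrib sum.distrib)
  qed
  moreover have "b k \<in> ?W"
  proof (rule range_eqI)
    have "(\<Sum>j\<le>d. (if j = k then 1 else 0) *v b j) = (\<Sum>j\<le>d. if j = k then b j else 0)"
      by (intro sum.cong) auto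
    then show "b k = (\<Sum>j\<le>d. (if j = k then 1 else 0) *v b j)" using k by simp
  qed
  ultimately have "?W = UNIV" using simple[of ?W] k by (auto simp: b_def)
  then have "\<forall>v. \<exists>c. v = (\<Sum>j\<le>d. c j *v b j)" by (metis (no_types, lifting) UNIV_I rangeE)
  then have "matrix_basis b" using act indep unfolding matrix_basis_def by blast
  then show ?thesis by blast
qed

lemma act_eqI:
  assumes "\<And>v. act x v = act y v"
  shows "x = y"
proof (rule \<rho>_eqI)
  fix i j assume ij: "i \<le> d" "j \<le> d"
  obtain b where b: "matrix_basis b" using ex_matrix_basis by blast
  have "(\<Sum>i\<le>d. (\<rho> x $$ (i, j) - \<rho> y $$ (i, j)) *v b i) = act x (b j) - act y (b j)"
    using ij by (simp add: matrix_basis_act[OF b] V.scale_left_diff_distrib sum_subtractf)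
  also have "\<dots> = 0" by (simp add: assms)
  finally have "\<rho> x $$ (i, j) - \<rho> y $$ (i, j) = 0"
    using ij(1) by (rule matrix_basis_indep[OF b])
  then show "\<rho> x $$ (i, j) = \<rho> y $$ (i, j)" by simp
qed

lemma eigenvalue_act:
  assumes "eigenvalue (\<rho> x) t"
  shows "\<exists>v. v \<noteq> 0 \<and> act x v = t *v v"
proof -
  obtain b where b: "matrix_basis b" using ex_matrix_basis by blast
  obtain w where w: "w \<in> carrier_vec (d + 1)" "w \<noteq> 0\<^sub>v (d + 1)" "\<rho> x *\<^sub>v w = t \<cdot>\<^sub>v w"
    using assms \<rho>_carrier[of x] by (auto simp: eigenvalue_def eigenvector_def)
  let ?v = "\<Sum>j\<le>d. (w $ j) *v b j"
  have entry: "(\<Sum>j\<le>d. \<rho> x $$ (i, j) * w $ j) = t * w $ i" if i: "i \<le> d" for i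
  proof -
    have "(\<rho> x *\<^sub>v w) $ i = (\<Sum>j\<le>d. \<rho> x $$ (i, j) * w $ j)"
      using \<rho>_carrier[of x] w(1) i
      by (simp add: scalar_prod_def atLeast0LessThan lessThan_Suc_atMost)
    then show ?thesis using w i by simp
  qed
  have "act x ?v = (\<Sum>i\<le>d. (\<Sum>j\<le>d. \<rho> x $$ (i, j) * w $ j) *v b i)"
    by (intro act_combination) (simp add: matrix_basis_act[OF b])
  also have "\<dots> = t *v ?v" by (simp add: entry V.scale_sum_right)
  finally have "act x ?v = t *v ?v" .
  moreover have "?v \<noteq> 0"
  proof
    assume "?v = 0"
    then have "\<forall>j\<le>d. w $ j = 0" using matrix_basis_indep[OF b] by blast
    then have "w = 0\<^sub>v (d + 1)" using w(1) by (intro eq_vecI) auto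
    then show False using w(2) by contradiction
  qed
  ultimately show ?thesis by blast
qed

lemma act_primitive_idempotent:
  assumes \<theta>: "inj_on \<theta> {..d}" and ij: "i \<le> d" "j \<le> d" and w: "act x w = \<theta> j *v w"
  shows "act (primitive_idempotent scale d x \<theta> i) w = (if i = j then w else 0)"
proof -
  have factor: "act (scale (1 / (\<theta> i - \<theta> h)) (x - scale (\<theta> h) 1)) w =
      ((\<theta> j - \<theta> h) / (\<theta> i - \<theta> h)) *v w" for h
  proof -
    have "act (x - scale (\<theta> h) 1) w + act (scale (\<theta> h) 1) w = act x w"
      by (simp flip: act_add_left)
    then have "act (x - scale (\<theta> h) 1) w = (\<theta> j - \<theta> h) *v w"
      using w by (simp add: V.scale_left_diff_distrib act_scale act_one eq_diff_eq)
    then show ?thesis by (simp add: act_scale)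
  qed
  have "act (prod_list (map (\<lambda>h. scale (1 / (\<theta> i - \<theta> h)) (x - scale (\<theta> h) 1)) hs)) w =
      (\<Prod>h\<leftarrow>hs. (\<theta> j - \<theta> h) / (\<theta> i - \<theta> h)) *v w" for hs
    by (induction hs) (simp_all add: act_one act_mult factor act_smul mult.commute)
  then have *: "act (primitive_idempotent scale d x \<theta> i) w =
      (\<Prod>h\<leftarrow>filter (\<lambda>h. h \<noteq> i) [0..<d + 1]. (\<theta> j - \<theta> h) / (\<theta> i - \<theta> h)) *v w"
    unfolding primitive_idempotent_def .
  have **: "(\<Prod>h\<leftarrow>hs. (\<theta> j - \<theta> h) / (\<theta> i - \<theta> h)) = (if i = j then 1 else 0)"
    if "set hs = {..d} - {i}" for hs
  proof (cases "i = j")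
    case True
    have "(\<Prod>h\<leftarrow>hs. (\<theta> j - \<theta> h) / (\<theta> i - \<theta> h)) = (\<Prod>h\<leftarrow>hs. 1)"
      using True ij \<theta> that
      by (intro arg_cong[where f = prod_list] map_cong) (auto simp: inj_on_def)
    also have "(\<Prod>h\<leftarrow>hs. 1) = (1 :: 'k)" by (induction hs) simp_all
    finally show ?thesis using True by simp
  next
    case False
    then have "j \<in> set hs" using that ij by auto
    then show ?thesis using False by (auto simp: prod_list_zero_iff)
  qed
  have "set (filter (\<lambda>h. h \<noteq> i) [0..<d + 1]) = {..d} - {i}"
    unfolding set_filter set_upt by auto
  from **[OF this] show ?thesis unfolding * by simp
qed

text \<open>
  Each of the \<open>d + 1\<close> eigenvalues has an eigenvector in the module. The primitive idempotents
  separate these vectors, so they are independent, and a dimension count makes them a basis.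
\<close>

lemma eigen_decomposition_act:
  assumes "associated_eigenvalues scale d \<rho> x E \<theta>"
  shows "eigen_decomposition smul d (act x) (\<lambda>i. act (E i)) \<theta>"
proof -
  have inj: "inj_on \<theta> {..d}" and ev: "\<And>i. i \<le> d \<Longrightarrow> eigenvalue (\<rho> x) (\<theta> i)"
    and E: "\<And>i. i \<le> d \<Longrightarrow> E i = primitive_idempotent scale d x \<theta> i"
    using assms by (auto simp: associated_eigenvalues_def bij_betw_def)
  have "\<forall>i. \<exists>w. i \<le> d \<longrightarrow> w \<noteq> 0 \<and> act x w = \<theta> i *v w"
    using eigenvalue_act[OF ev] by blast
  then obtain w where w: "\<And>i. i \<le> d \<Longrightarrow> w i \<noteq> 0" "\<And>i. i \<le> d \<Longrightarrow> act x (w i) = \<theta> i *v w i"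
    by metis
  have Ew: "act (E i) (w j) = (if i = j then w j else 0)" if "i \<le> d" "j \<le> d" for i j
    using act_primitive_idempotent[OF inj that w(2)] that E by simp
  have Esum: "act (E i) (\<Sum>j\<le>d. c j *v w j) = c i *v w i" if i: "i \<le> d" for i c
  proof -
    have "act (E i) (\<Sum>j\<le>d. c j *v w j) = (\<Sum>j\<le>d. if j = i then c j *v w j else 0)"
      unfolding act_simps using i by (intro sum.cong) (auto simp: Ew)
    then show ?thesis using i by simp
  qed
  have injw: "inj_on w {..d}"
  proof (rule inj_onI)
    fix i j assume "i \<in> {..d}" "j \<in> {..d}" "w i = w j"
    then show "i = j" using Ew[of i i] Ew[of i j] w(1)[of i] by (auto split: if_splits)
  qed
  have indep: "V.independent (w ` {..d})"
  proof (rule V.independent_if_scalars_zero)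
    fix f v assume f: "(\<Sum>v\<in>w ` {..d}. f v *v v) = 0" and "v \<in> w ` {..d}"
    then obtain i where i: "i \<le> d" "v = w i" by auto
    have "(\<Sum>j\<le>d. f (w j) *v w j) = 0" using f injw by (simp add: sum.reindex)
    then show "f v = 0" using Esum[OF i(1), of "\<lambda>j. f (w j)"] w(1)[OF i(1)] i by (simp add: act_simps)
  qed simp
  have span: "\<exists>c. v = (\<Sum>j\<le>d. c j *v w j)" for v
  proof -
    \<comment> \<open>A vector outside the span would give \<open>d + 2\<close> independent vectors in the span of the
      \<open>d + 1\<close> vectors of a matrix basis.\<close>
    have "v \<in> V.span (w ` {..d})"
    proof (rule ccontr)
      assume v: "v \<notin> V.span (w ` {..d})"
      obtain b where b: "matrix_basis b" using ex_matrix_basis by blast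
      have "z \<in> V.span (b ` {..d})" for z
      proof -
        obtain c where "z = (\<Sum>j\<le>d. c j *v b j)" using matrix_basis_span[OF b] by blast
        moreover have "(\<Sum>j\<le>d. c j *v b j) \<in> V.span (b ` {..d})"
          by (intro V.span_sum V.span_scale V.span_base) simp
        ultimately show ?thesis by simp
      qed
      then have "card (insert v (w ` {..d})) \<le> card (b ` {..d})"
        using V.independent_span_bound[OF _ V.independent_insertI[OF v indep], of "b ` {..d}"] by auto
      also have "\<dots> \<le> d + 1" using card_image_le[of "{..d}" b] by simp
      finally have "card (insert v (w ` {..d})) \<le> d + 1" .
      moreover have "v \<notin> w ` {..d}" using v V.span_base[of v "w ` {..d}"] by blast
      ultimately show False using card_image[OF injw] by simp
    qed
    then obtain f where "v = (\<Sum>z\<in>w ` {..d}. f z *v z)" by (auto simp: V.span_finite)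
    then show ?thesis using injw by (auto simp: sum.reindex)
  qed
  show ?thesis
  proof (intro eigen_decomposition.intro eigen_decomposition_axioms.intro)
    show "vector_space smul" by (rule V.vector_space_axioms)
    show "module_hom smul smul (act x)" "module_hom smul smul (act (E i))" for i
      by (rule act_hom)+
    show "inj_on \<theta> {..d}" by (rule inj)
    fix i assume i: "i \<le> d"
    show "\<exists>v. act (E i) v \<noteq> 0" by (rule exI[of _ "w i"]) (simp add: Ew i w(1))
    fix v
    obtain c where c: "v = (\<Sum>j\<le>d. c j *v w j)" using span by blast
    show "act (E i) (act (E j) v) = (if i = j then act (E j) v else 0)" if "j \<le> d" for j
      using that i by (simp add: c Esum act_smul Ew act_simps(1))
    show "act x (act (E i) v) = \<theta> i *v act (E i) v"
      using i by (simp add: c Esum act_smul w mult.commute)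
    fix y assume nz: "act (E i) v \<noteq> 0"
    obtain c' where c': "y = (\<Sum>j\<le>d. c' j *v w j)" using span by blast
    have "c i \<noteq> 0" using nz i by (auto simp: c Esum)
    then have "act (E i) y = (c' i / c i) *v act (E i) v"
      using i by (simp add: c c' Esum)
    then show "\<exists>k. act (E i) y = k *v act (E i) v" by blast
  next
    fix v
    obtain c where c: "v = (\<Sum>j\<le>d. c j *v w j)" using span by blast
    show "(\<Sum>i\<le>d. act (E i) v) = v"
      by (simp add: c Esum)
  qed
qed

text \<open>
  In coordinates, if \<open>F v = f(v) z\<close> then the diagonal entries of \<open>x F\<close> are the products of the
  values of \<open>f\<close> on the basis with the coordinates of \<open>x z\<close>, so that the trace is \<open>f(x z)\<close>.
\<close>

lemma act_mult_rank1:
  assumes F: "\<And>v. \<exists>c. act F v = c *v z"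
  shows "act F (act x z) = alg_trace d \<rho> (x * F) *v z"
proof -
  obtain b where b: "matrix_basis b" using ex_matrix_basis by blast
  obtain f where f: "\<And>v. act F v = f v *v z" using F by metis
  obtain h where h: "act x z = (\<Sum>i\<le>d. h i *v b i)"
    using matrix_basis_span[OF b] by blast
  have "\<rho> (x * F) $$ (i, i) = f (b i) * h i" if i: "i \<le> d" for i
  proof -
    have "(\<Sum>j\<le>d. (\<rho> (x * F) $$ (j, i) - f (b i) * h j) *v b j) =
        act (x * F) (b i) - f (b i) *v act x z"
      using i by (simp add: matrix_basis_act[OF b] h V.scale_left_diff_distrib sum_subtractf V.scale_sum_right)
    also have "\<dots> = 0" by (simp add: act_mult f act_smul)
    finally have "\<rho> (x * F) $$ (i, i) - f (b i) * h i = 0"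
      using i by (rule matrix_basis_indep[OF b])
    then show ?thesis by simp
  qed
  then have "alg_trace d \<rho> (x * F) = (\<Sum>i\<le>d. h i * f (b i))"
    by (simp add: alg_trace_def mult.commute)
  then show ?thesis by (simp add: h act_simps f V.scale_sum_left)
qed

lemma act_poly_eval:
  assumes "act x w = \<mu> *v w"
  shows "act (poly_eval scale p x) w = poly p \<mu> *v w"
proof -
  have "act (x ^ n) w = \<mu> ^ n *v w" for n
    by (induction n) (simp_all add: act_one act_mult act_smul assms power_commutes power_Suc2 del: power_Suc)
  then show ?thesis
    by (simp add: poly_eval_def act_sum_left act_scale poly_altdef V.scale_sum_left)
qed

lemma act_tau_poly:
  assumes "eigen_decomposition smul d (act x) F \<theta>"
  shows "act (poly_eval scale (tau_poly \<theta> i) x) v = eigen_decomposition.newton_vec smul d F \<theta> v i"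
proof -
  interpret D: eigen_decomposition smul d "act x" F \<theta> by (rule assms)
  have "act (poly_eval scale (tau_poly \<theta> i) x) v =
      act (poly_eval scale (tau_poly \<theta> i) x) (\<Sum>r\<le>d. F r v)"
    by (simp only: D.sum_E)
  also have "\<dots> = (\<Sum>r\<le>d. poly (tau_poly \<theta> i) (\<theta> r) *v F r v)"
    by (simp add: act_simps act_poly_eval[OF D.T_E])
  finally show ?thesis
    by (simp add: D.newton_vec_def D.newton_def tau_poly_def poly_prod)
qed

lemma flag_up_iff:
  assumes "eigen_decomposition smul d T (\<lambda>i. act (E i)) \<theta>" and i: "i \<le> d"
  shows "flag_up act E i = {v. \<forall>r\<le>d. i < r \<longrightarrow> act (E r) v = 0}"
proof -
  interpret D: eigen_decomposition smul d T "\<lambda>i. act (E i)" \<theta> by (rule assms)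
  show ?thesis
  proof (intro Set.set_eqI iffI)
    fix v assume "v \<in> flag_up act E i"
    then obtain f where f: "v = (\<Sum>j\<le>i. f j)" "\<forall>j\<le>i. f j \<in> range (act (E j))"
      by (auto simp: flag_up_def set_sum_alt)
    have "act (E r) (f j) = 0" if "j \<le> i" "i < r" "r \<le> d" for j r
    proof -
      have "f j \<in> range (act (E j))" using f(2) that by blast
      then show ?thesis using that i by (auto simp: D.E_E)
    qed
    with f(1) show "v \<in> {v. \<forall>r\<le>d. i < r \<longrightarrow> act (E r) v = 0}"
      by (auto simp: act_simps)
  next
    fix v assume v: "v \<in> {v. \<forall>r\<le>d. i < r \<longrightarrow> act (E r) v = 0}"
    have "(\<Sum>j\<le>d. act (E j) v) = (\<Sum>j\<le>i. act (E j) v)"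
      using v i by (intro sum.mono_neutral_right) auto
    then have "v = (\<Sum>j\<le>i. act (E j) v)" by (simp add: D.sum_E)
    then show "v \<in> flag_up act E i" by (auto simp: flag_up_def set_sum_alt)
  qed
qed

lemma flag_down_iff:
  assumes "eigen_decomposition smul d T (\<lambda>i. act (E i)) \<theta>" and i: "i \<le> d"
  shows "flag_down act d E i = {v. \<forall>r<d - i. act (E r) v = 0}"
proof -
  interpret D: eigen_decomposition smul d T "\<lambda>i. act (E i)" \<theta> by (rule assms)
  have "flag_down act d E i = flag_up act (\<lambda>j. E (d - j)) i"
    by (simp add: flag_down_def flag_up_def)
  also have "\<dots> = {v. \<forall>r\<le>d. i < r \<longrightarrow> act (E (d - r)) v = 0}"
    by (rule flag_up_iff[OF D.reverse i])
  also have "\<dots> = {v. \<forall>r<d - i. act (E r) v = 0}"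
  proof (intro Collect_cong iffI allI impI)
    fix v r assume v: "\<forall>r\<le>d. i < r \<longrightarrow> act (E (d - r)) v = 0" and "r < d - i"
    then have "d - r \<le> d" "i < d - r" "d - (d - r) = r" by auto
    then show "act (E r) v = 0" using v by metis
  next
    fix v r assume "\<forall>r<d - i. act (E r) v = 0" "r \<le> d" "i < r"
    then show "act (E (d - r)) v = 0" by auto
  qed
  finally show ?thesis .
qed

end

section \<open>Leonard systems in a matrix algebra\<close>

context matrix_algebra_module
begin

lemma leonard_action_act:
  assumes L: "leonard_system scale d \<rho> A E As Es"
    and "associated_eigenvalues scale d \<rho> A E \<theta>"
    and "associated_eigenvalues scale d \<rho> As Es \<theta>s"
  shows "leonard_action smul d (act A) (\<lambda>i. act (E i)) \<theta> (act As) (\<lambda>i. act (Es i)) \<theta>s"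
proof -
  have nz: "\<exists>v. act x (act y (act z v)) \<noteq> 0" if "x * y * z \<noteq> 0" for x y z
  proof (rule ccontr)
    assume "\<nexists>v. act x (act y (act z v)) \<noteq> 0"
    then have "act (x * y * z) v = act 0 v" for v by (simp add: act_mult act_zero_left)
    then have "x * y * z = 0" by (rule act_eqI)
    then show False using that by contradiction
  qed
  have z: "act x (act y (act z v)) = 0" if "x * y * z = 0" for x y z v
    using arg_cong[OF that, of "\<lambda>x. act x v"] by (simp add: act_mult act_zero_left)
  show ?thesis
  proof (intro leonard_action.intro leonard_action_axioms.intro)
    show "eigen_decomposition smul d (act A) (\<lambda>i. act (E i)) \<theta>"
      "eigen_decomposition smul d (act As) (\<lambda>i. act (Es i)) \<theta>s"
      using assms eigen_decomposition_act by auto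
  next
    fix i j v assume ij: "i \<le> d" "j \<le> d" "1 < \<bar>int i - int j\<bar>"
    then have "E i * As * E j = 0" "Es i * A * Es j = 0"
      using L by (auto simp: leonard_system_def)
    then show "act (E i) (act As (act (E j) v)) = 0" "act (Es i) (act A (act (Es j) v)) = 0"
      by (simp_all add: z)
  next
    fix i j assume ij: "i \<le> d" "j \<le> d" "\<bar>int i - int j\<bar> = 1"
    then have "E i * As * E j \<noteq> 0" "Es i * A * Es j \<noteq> 0"
      using L by (auto simp: leonard_system_def)
    then show "\<exists>v. act (E i) (act As (act (E j) v)) \<noteq> 0"
      "\<exists>v. act (Es i) (act A (act (Es j) v)) \<noteq> 0"
      by (simp_all add: nz)
  qed
qed

text \<open>
  The traces in the split sequences are the coordinates of \<open>\<tau>\<^sub>i(A) x\<close> and \<open>\<eta>\<^sub>i(A) x\<close> along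
  \<open>x\<close>, because \<open>Es 0\<close> has rank one; and \<open>\<eta>\<^sub>i\<close> is \<open>\<tau>\<^sub>i\<close> for the reversed eigenvalues.
\<close>

lemma act_switching_element:
  assumes "switching smul d (act A) (\<lambda>i. act (E i)) \<theta> (act As) (\<lambda>i. act (Es i)) \<theta>s x y"
  shows "act (switching_element scale d \<rho> A E \<theta> Es \<theta>s) v =
    switching.switch smul d (\<lambda>i. act (E i)) \<theta> (\<lambda>i. act (Es i)) \<theta>s x v"
proof -
  interpret switching smul d "act A" "\<lambda>i. act (E i)" \<theta> "act As" "\<lambda>i. act (Es i)" \<theta>s x y
    by (rule assms)
  have tr: "act (Es 0) (act p x) = alg_trace d \<rho> (p * Es 0) *v x" for p
    by (rule act_mult_rank1) (rule Es_0_multiple)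
  have "u_coord i = alg_trace d \<rho> (poly_eval scale (tau_poly \<theta> i) A * Es 0)" for i
    by (rule u_coord_eqI) (simp add: act_tau_poly[OF A.eigen_decomposition_axioms] flip: tr)
  then have first: "first_split scale d \<rho> A \<theta> Es \<theta>s = split_param"
    by (simp add: fun_eq_iff first_split_def split_param_def)
  have eta: "eta_poly d \<theta> i = tau_poly (\<lambda>i. \<theta> (d - i)) i" for i
    by (simp add: eta_poly_def tau_poly_def)
  have "rev.u_coord i = alg_trace d \<rho> (poly_eval scale (eta_poly d \<theta> i) A * Es 0)" for i
    by (rule rev.u_coord_eqI) (simp add: eta act_tau_poly[OF A.reverse] flip: tr)
  then have second: "second_split scale d \<rho> A \<theta> Es \<theta>s = rev.split_param"
    by (simp add: fun_eq_iff second_split_def rev.split_param_def)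
  show ?thesis
    by (simp add: switching_element_def first second switch_def switch_coeff_def act_sum_left act_scale)
qed

lemma leonard_switching:
  assumes "leonard_action smul d (act A) E \<theta> (act As) Es \<theta>s"
  shows "\<exists>x y. switching smul d (act A) E \<theta> (act As) Es \<theta>s x y"
proof -
  interpret leonard_action smul d "act A" E \<theta> "act As" Es \<theta>s by (rule assms)
  obtain v w where v: "Es 0 v \<noteq> 0" and w: "Es d w \<noteq> 0"
    using B.E_nonzero[of 0] B.E_nonzero[of d] by auto
  have "switching smul d (act A) E \<theta> (act As) Es \<theta>s (Es 0 v) (Es d w)"
    using v w assms reverse_E reverse_Es
    by (simp add: switching_def leonard_vector_def leonard_vector_axioms_def B.E_E)
  then show ?thesis by blast
qed

end

theorem theorem9p1:
  fixes scale :: "'k::field \<Rightarrow> 'a::ring_1 \<Rightarrow> 'a"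
    and d :: nat
    and \<rho> :: "'a \<Rightarrow> 'k mat"
    and act :: "'a \<Rightarrow> 'v::ab_group_add \<Rightarrow> 'v"
    and A As X S :: 'a
    and E Es :: "nat \<Rightarrow> 'a"
    and \<theta> \<theta>s :: "nat \<Rightarrow> 'k"
  assumes "matrix_algebra scale d \<rho>"
    and "simple_left_module act"
    and "leonard_system scale d \<rho> A E As Es"
    and "associated_eigenvalues scale d \<rho> A E \<theta>"
    and "associated_eigenvalues scale d \<rho> As Es \<theta>s"
    and "S = switching_element scale d \<rho> A E \<theta> Es \<theta>s"
    and "X \<noteq> 0"
  shows "((\<exists>c. X = scale c S) \<longleftrightarrow>
           (flag_subset d (flag_image act X (flag_up act E)) (flag_up act E) \<and>
            flag_subset d (flag_image act X (flag_down act d E)) (flag_down act d E) \<and>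
            flag_subset d (flag_image act X (flag_up act Es)) (flag_down act d Es)))
       \<and> ((\<exists>c. X = scale c S) \<and>
           (flag_subset d (flag_image act X (flag_up act E)) (flag_up act E) \<and>
            flag_subset d (flag_image act X (flag_down act d E)) (flag_down act d E) \<and>
            flag_subset d (flag_image act X (flag_up act Es)) (flag_down act d Es))
          \<longrightarrow>
           (flag_eq d (flag_image act X (flag_up act E)) (flag_up act E) \<and>
            flag_eq d (flag_image act X (flag_down act d E)) (flag_down act d E) \<and>
            flag_eq d (flag_image act X (flag_up act Es)) (flag_down act d Es)))"
proof -
  interpret matrix_algebra_module scale d \<rho> act
    using assms(1,2) by (rule matrix_algebra_module.intro)
  have L: "leonard_action smul d (act A) (\<lambda>i. act (E i)) \<theta> (act As) (\<lambda>i. act (Es i)) \<theta>s"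
    using assms(3-5) by (rule leonard_action_act)
  then obtain x y where
    xy: "switching smul d (act A) (\<lambda>i. act (E i)) \<theta> (act As) (\<lambda>i. act (Es i)) \<theta>s x y"
    using leonard_switching by blast
  interpret switching smul d "act A" "\<lambda>i. act (E i)" \<theta> "act As" "\<lambda>i. act (Es i)" \<theta>s x y
    by (rule xy)
  have S: "act S v = switch v" for v
    using act_switching_element[OF xy] assms(6) by simp
  note up = flag_up_iff[OF A.eigen_decomposition_axioms]
  note down = flag_down_iff[OF A.eigen_decomposition_axioms]
  note up_s = flag_up_iff[OF B.eigen_decomposition_axioms]
  note down_s = flag_down_iff[OF B.eigen_decomposition_axioms]
  let ?eq = "flag_eq d (flag_image act X (flag_up act E)) (flag_up act E) \<and>
    flag_eq d (flag_image act X (flag_down act d E)) (flag_down act d E) \<and>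
    flag_eq d (flag_image act X (flag_up act Es)) (flag_down act d Es)"
  let ?sub = "flag_subset d (flag_image act X (flag_up act E)) (flag_up act E) \<and>
    flag_subset d (flag_image act X (flag_down act d E)) (flag_down act d E) \<and>
    flag_subset d (flag_image act X (flag_up act Es)) (flag_down act d Es)"
  have eq: ?eq if "\<exists>c. X = scale c S"
  proof -
    obtain c where c: "X = scale c S" using \<open>\<exists>c. X = scale c S\<close> by blast
    have X: "act X v = c *v switch v" for v by (simp add: c act_scale S)
    have c0: "c \<noteq> 0" using c \<open>X \<noteq> 0\<close> by auto
    have surj: "\<exists>w. act X w = v" for v
    proof -
      obtain w where "switch w = (1 / c) *v v" using switch_surj by blast
      then have "act X w = v" using c0 by (simp add: X)
      then show ?thesis by blast
    qed
    have image: "act X ` F = G" if "\<And>v. v \<in> F \<longleftrightarrow> act X v \<in> G" for F G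
      using that surj by (auto simp: image_iff) metis
    have E: "act (E r) (act X v) = 0 \<longleftrightarrow> act (E r) v = 0" if "r \<le> d" for r v
      using that c0 switch_coeff_nonzero by (simp add: X act_simps E_switch)
    have Es: "act (Es r) (act X v) = 0 \<longleftrightarrow> act (Es r) (switch v) = 0" for r v
      using c0 by (simp add: X act_simps)
    show ?eq
      unfolding flag_eq_def flag_image_def
    proof (intro conjI allI impI image)
      fix i v assume i: "i \<le> d"
      show "v \<in> flag_up act E i \<longleftrightarrow> act X v \<in> flag_up act E i"
        using i by (auto simp: up E)
      show "v \<in> flag_down act d E i \<longleftrightarrow> act X v \<in> flag_down act d E i"
        using i by (auto simp: down E)
      show "v \<in> flag_up act Es i \<longleftrightarrow> act X v \<in> flag_down act d Es i"
        using switch_flag[OF i, of v] i by (simp add: up_s down_s Es)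
    qed
  qed
  have scalar: "\<exists>c. X = scale c S" if ?sub
  proof -
    have sub: "act X v \<in> flag_up act E i" if "i \<le> d" "v \<in> flag_up act E i" for i v
      using \<open>?sub\<close> that by (auto simp: flag_subset_def flag_image_def image_subset_iff)
    have sub': "act X v \<in> flag_down act d E i" if "i \<le> d" "v \<in> flag_down act d E i" for i v
      using \<open>?sub\<close> that by (auto simp: flag_subset_def flag_image_def image_subset_iff)
    have sub_s: "act X v \<in> flag_down act d Es i" if "i \<le> d" "v \<in> flag_up act Es i" for i v
      using \<open>?sub\<close> that by (auto simp: flag_subset_def flag_image_def image_subset_iff)
    have "\<exists>c. \<forall>v. act X v = c *v switch v"
    proof (rule switch_unique[OF act_hom])
      fix i j v assume ij: "i \<le> d" "j \<le> d" "i \<noteq> j"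
      \<comment> \<open>Stability of the up flag excludes the entries with \<open>j < i\<close>, stability of the down flag
        those with \<open>i < j\<close>.\<close>
      show "act (E i) (act X (act (E j) v)) = 0"
      proof (cases "j < i")
        case True
        have "act (E j) v \<in> flag_up act E j" using ij by (simp add: up A.E_E)
        then show ?thesis using sub[of j] ij True by (simp add: up)
      next
        case False
        have "act (E j) v \<in> flag_down act d E (d - j)" using ij by (simp add: down A.E_E)
        then show ?thesis using sub'[of "d - j"] ij False by (simp add: down)
      qed
    next
      fix r assume r: "r < d"
      have "act (Es q) x = 0" if "0 < q" "q \<le> d" for q
        using B.E_E[of q 0 x] that Es_0_x by simp
      then have "x \<in> flag_up act Es 0" by (simp add: up_s)
      then show "act (Es r) (act X x) = 0" using sub_s[of 0 x] r by (simp add: down_s)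
    qed
    then obtain c where "\<And>v. act X v = act (scale c S) v" by (auto simp: act_scale S)
    then show ?thesis using act_eqI by blast
  qed
  have "?sub" if ?eq
    using that by (auto simp: flag_eq_def flag_subset_def)
  then show ?thesis using eq scalar by blast
qed

end
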